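(* Consider the linear regression model $Y_i=\beta_0+\sum_{j=1}^p\beta_jx_{ij}+\varepsilon_i$, $i=1,\dots,n$, with deterministic design, where $\varepsilon_1,\dots,\varepsilon_n$ are i.i.d. Gaussian $\mathcal{N}(0,\sigma^2)$, and let $p\ge n$. Let $k>1$ be fixed, $K=kp_0$, and assume the consistency condition $$\lim_{n\to\infty}\min\left\{\frac{\Delta(s)}{p_0\ln p}\colon s_0\nsubseteq s,\ k(s)\le K\right\}=\infty .$$ Let $\mathrm{mBIC2}(s)=n\ln \mathrm{RSS}(s)+k(s)\ln n+2k(s)\ln p-2\ln(k(s)!)$. If $p_0^2\ln p=O(n^\alpha)$ and $\ln p=o(n^{1-\alpha}\ln n)$ for some $\alpha\in[\tfrac12,1)$, then $\mathrm{mBIC2}$ is consistent, that is, $$\mathrm{P}\left(\mathrm{mBIC2}(s)>\mathrm{mBIC2}(s_0)\ \text{ for all } s\ne s_0 \text{ with } k(s)\le K\right)\xrightarrow{n\to\infty}1 .$$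
   Context: Asymptotics are as $n\to\infty$. The number of predictors $p=p_n$, the design $(x_{ij})$, the coefficients $\beta_0,\beta_1,\dots,\beta_p$, the true model and its size $p_0\ge1$ may all depend on $n$; $\sigma>0$, $k$ and $\alpha$ do not. Models are subsets $s\subseteq\{1,\dots,p\}$, and $k(s)$ is the number of elements of $s$. The true model is $s_0=\{j\in\{1,\dots,p\}\colon\beta_j\ne0\}$, and $p_0=k(s_0)$. $X(s)$ is the matrix formed by the columns $(x_{1j},\dots,x_{nj})^T$ of the design with indices $j\in s$, together with the intercept column of ones, which belongs to every model and is not counted in $k(s)$; $\beta(s)$ is the corresponding vector of coefficients. $H(s)$ is the matrix of the orthogonal projection of $\mathbb{R}^n$ onto the span of the columns of $X(s)$. $\mathrm{RSS}(s)=Y^T[I-H(s)]Y$ is the residual sum of squares of model $s$. Further, $\mu=X(s_0)\beta(s_0)$ and $\Delta(s)=\|\mu-H(s)\mu\|^2$ (Euclidean norm). *)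

theory Defs
  imports
    "HOL-Probability.Probability"
    "HOL-Library.Landau_Symbols"
    "Jordan_Normal_Form.VS_Connect"
begin

unbundle no vec_syntax and no inner_syntax

text \<open>
  Observations are numbered \<open>1, \<dots>, n\<close> and predictors \<open>1, \<dots>, p\<close>; index \<open>0\<close> of a coefficient
  vector \<open>\<beta>\<close> is the intercept. Vectors in \<open>\<real>\<^sup>n\<close> are \<^typ>\<open>real vec\<close>, whose entries are
  numbered from \<open>0\<close>, whence the shifts by \<^const>\<open>Suc\<close>.
\<close>

definition true_model :: "nat \<Rightarrow> (nat \<Rightarrow> real) \<Rightarrow> nat set" where
  "true_model p \<beta> = {j \<in> {1..p}. \<beta> j \<noteq> 0}"

definition model_cols :: "nat \<Rightarrow> (nat \<Rightarrow> nat \<Rightarrow> real) \<Rightarrow> nat set \<Rightarrow> real vec list" where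
  "model_cols n x s =
     vec n (\<lambda>_. 1) # map (\<lambda>j. vec n (\<lambda>i. x (Suc i) j)) (sorted_list_of_set s)"

definition design_matrix :: "nat \<Rightarrow> (nat \<Rightarrow> nat \<Rightarrow> real) \<Rightarrow> nat set \<Rightarrow> real mat" where
  "design_matrix n x s = mat_of_cols n (model_cols n x s)"

definition coef_vec :: "(nat \<Rightarrow> real) \<Rightarrow> nat set \<Rightarrow> real vec" where
  "coef_vec \<beta> s = vec_of_list (\<beta> 0 # map \<beta> (sorted_list_of_set s))"

definition is_orth_proj_mat :: "nat \<Rightarrow> real vec set \<Rightarrow> real mat \<Rightarrow> bool" where
  "is_orth_proj_mat n W P \<longleftrightarrow> P \<in> carrier_mat n n \<and>
     (\<forall>v \<in> carrier_vec n. P *\<^sub>v v \<in> W \<and> v - P *\<^sub>v v \<in> vec_module.orthogonal_complement n W)"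

text \<open>Existence and uniqueness of this matrix are shown in \<open>hat_matrix_ex1\<close> below; the columns
  of the design matrix need not be linearly independent.\<close>

definition hat_matrix :: "nat \<Rightarrow> (nat \<Rightarrow> nat \<Rightarrow> real) \<Rightarrow> nat set \<Rightarrow> real mat" where
  "hat_matrix n x s =
     (THE P. is_orth_proj_mat n (vec_space.col_space n (design_matrix n x s)) P)"

definition mean_vec :: "nat \<Rightarrow> nat \<Rightarrow> (nat \<Rightarrow> nat \<Rightarrow> real) \<Rightarrow> (nat \<Rightarrow> real) \<Rightarrow> real vec" where
  "mean_vec n p x \<beta> =
     design_matrix n x (true_model p \<beta>) *\<^sub>v coef_vec \<beta> (true_model p \<beta>)"

definition model_gap ::
    "nat \<Rightarrow> nat \<Rightarrow> (nat \<Rightarrow> nat \<Rightarrow> real) \<Rightarrow> (nat \<Rightarrow> real) \<Rightarrow> nat set \<Rightarrow> real" where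
  "model_gap n p x \<beta> s =
     (let \<mu> = mean_vec n p x \<beta>; r = \<mu> - hat_matrix n x s *\<^sub>v \<mu> in r \<bullet> r)"

definition response ::
    "nat \<Rightarrow> nat \<Rightarrow> (nat \<Rightarrow> nat \<Rightarrow> real) \<Rightarrow> (nat \<Rightarrow> real) \<Rightarrow> (nat \<Rightarrow> real) \<Rightarrow> real vec" where
  "response n p x \<beta> e =
     vec n (\<lambda>i. \<beta> 0 + (\<Sum>j = 1..p. \<beta> j * x (Suc i) j) + e (Suc i))"

definition RSS :: "nat \<Rightarrow> (nat \<Rightarrow> nat \<Rightarrow> real) \<Rightarrow> real vec \<Rightarrow> nat set \<Rightarrow> real" where
  "RSS n x y s = y \<bullet> ((1\<^sub>m n - hat_matrix n x s) *\<^sub>v y)"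

text \<open>Pitfall: \<open>ln 0 = 0\<close> in HOL. Under Gaussian noise the residual sum of squares of a model with
  fewer than \<open>n - 1\<close> predictors is almost surely positive.\<close>

definition mBIC2 :: "nat \<Rightarrow> nat \<Rightarrow> (nat \<Rightarrow> nat \<Rightarrow> real) \<Rightarrow> real vec \<Rightarrow> nat set \<Rightarrow> real" where
  "mBIC2 n p x y s =
     real n * ln (RSS n x y s) + real (card s) * ln (real n)
       + 2 * real (card s) * ln (real p) - 2 * ln (fact (card s))"

definition models_upto :: "nat \<Rightarrow> real \<Rightarrow> nat set set" where
  "models_upto p K = {s. s \<subseteq> {1..p} \<and> real (card s) \<le> K}"

lemma orth_proj_mat_exists:
  assumes "set cs \<subseteq> carrier_vec n"
  shows "\<exists>P. is_orth_proj_mat n (vec_space.col_space n (mat_of_cols n cs)) P"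
proof -
  interpret V: vec_space "TYPE(real)" n .
  have "\<exists>P \<in> carrier_mat n n. \<forall>v \<in> carrier_vec n.
      P *\<^sub>v v \<in> V.span (set cs) \<and> v - P *\<^sub>v v \<in> V.orthogonal_complement (V.span (set cs))"
    using assms
  proof (induction cs)
    case Nil
    have "V.span {} = {0\<^sub>v n}"
      using V.span_empty by simp
    then have sp: "V.span (set []) = {0\<^sub>v n}"
      by (simp only: list.set(1))
    have oc: "V.orthogonal_complement {0\<^sub>v n} = carrier_vec n"
      unfolding V.orthogonal_complement_def using scalar_prod_right_zero by blast
    have "0\<^sub>m n n *\<^sub>v v \<in> {0\<^sub>v n} \<and> v - 0\<^sub>m n n *\<^sub>v v \<in> carrier_vec n"
      if v: "v \<in> carrier_vec n" for v :: "real vec"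
    proof -
      have z: "0\<^sub>m n n *\<^sub>v v = 0\<^sub>v n"
        using v by (intro eq_vecI) auto
      show ?thesis unfolding z minus_zero_vec[OF v] using v by blast
    qed
    then show ?case unfolding sp oc using zero_carrier_mat by blast
  next
    case (Cons w cs)
    then have w: "w \<in> carrier_vec n" and cs: "set cs \<subseteq> carrier_vec n" by auto
    obtain P where P: "P \<in> carrier_mat n n"
      and Pv: "\<And>v. v \<in> carrier_vec n \<Longrightarrow> P *\<^sub>v v \<in> V.span (set cs)"
      and Po: "\<And>v. v \<in> carrier_vec n \<Longrightarrow> v - P *\<^sub>v v \<in> V.orthogonal_complement (V.span (set cs))"
      using Cons.IH[OF cs] by blast
    have PvC: "P *\<^sub>v v \<in> carrier_vec n" if "v \<in> carrier_vec n" for v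
      using P that by simp
    define u where "u = w - P *\<^sub>v w"
    define c where "c = 1 / (u \<bullet> u)"
    define Q where "Q = P + c \<cdot>\<^sub>m mat n n (\<lambda>(i, j). u $ i * u $ j)"
    let ?W = "V.span (set (w # cs))"
    have ws: "set (w # cs) \<subseteq> carrier_vec n" using w cs by simp
    have u: "u \<in> carrier_vec n" unfolding u_def using w PvC by simp
    have uo: "u \<bullet> y = 0" if "y \<in> V.span (set cs)" for y
      using Po[OF w] that unfolding u_def V.orthogonal_complement_def by auto
    have sub: "V.span (set cs) \<subseteq> ?W"
      by (rule V.span_is_monotone) auto
    have wW: "w \<in> ?W"
      using V.in_own_span[OF ws] by auto
    have add: "a + b \<in> ?W" if "a \<in> ?W" "b \<in> ?W" for a b
      using V.span_add1[OF ws that] by simp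
    have uW: "u \<in> ?W"
    proof -
      have eq: "u = w + (-1) \<cdot>\<^sub>v (P *\<^sub>v w)"
        unfolding u_def using w PvC[OF w] by (intro eq_vecI) auto
      have "(-1) \<cdot>\<^sub>v (P *\<^sub>v w) \<in> ?W"
        by (rule V.smult_in_span[OF ws subsetD[OF sub Pv[OF w]]])
      then show ?thesis unfolding eq by (intro add[OF wW])
    qed
    have Q: "Q \<in> carrier_mat n n" unfolding Q_def using P by auto
    have Qv: "Q *\<^sub>v v = P *\<^sub>v v + (c * (u \<bullet> v)) \<cdot>\<^sub>v u" if v: "v \<in> carrier_vec n" for v
    proof (rule eq_vecI)
      fix i assume "i < dim_vec (P *\<^sub>v v + (c * (u \<bullet> v)) \<cdot>\<^sub>v u)"
      then have i: "i < n" using u by simp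
      show "(Q *\<^sub>v v) $ i = (P *\<^sub>v v + (c * (u \<bullet> v)) \<cdot>\<^sub>v u) $ i"
        unfolding Q_def using i v u P
        by (simp add: scalar_prod_def sum.distrib sum_distrib_left sum_distrib_right algebra_simps)
    qed (use Q u in auto)
    have "Q *\<^sub>v v \<in> ?W \<and> v - Q *\<^sub>v v \<in> V.orthogonal_complement ?W" if v: "v \<in> carrier_vec n" for v
    proof
      have "(c * (u \<bullet> v)) \<cdot>\<^sub>v u \<in> ?W" using V.smult_in_span[OF ws uW] .
      then show "Q *\<^sub>v v \<in> ?W"
        unfolding Qv[OF v] by (rule add[OF subsetD[OF sub Pv[OF v]]])
      let ?r = "v - P *\<^sub>v v"
      have rC: "?r \<in> carrier_vec n" using v PvC by simp
      have ro: "?r \<bullet> y = 0" if "y \<in> V.span (set cs)" for y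
        using Po[OF v] that unfolding V.orthogonal_complement_def by auto
      have eq: "v - Q *\<^sub>v v = ?r - (c * (u \<bullet> v)) \<cdot>\<^sub>v u"
      proof -
        have "a - (b + d) = a - b - d"
          if "a \<in> carrier_vec n" "b \<in> carrier_vec n" "d \<in> carrier_vec n" for a b d :: "real vec"
          using that by (intro eq_vecI) auto
        then show ?thesis unfolding Qv[OF v] using v u PvC[OF v] by blast
      qed
      have prod: "(v - Q *\<^sub>v v) \<bullet> y
          = ?r \<bullet> y - c * (u \<bullet> v) * (u \<bullet> y)"
        if y: "y \<in> carrier_vec n" for y
        unfolding eq minus_scalar_prod_distrib[OF rC smult_carrier_vec[THEN iffD2, OF u] y]
        using smult_scalar_prod_distrib[OF u y] by (simp only:)
      have cs0: "(v - Q *\<^sub>v v) \<bullet> y = 0" if "y \<in> V.span (set cs)" for y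
      proof -
        have "y \<in> carrier_vec n" using V.span_closed[OF _ that] cs by auto
        from prod[OF this] ro[OF that] uo[OF that] show ?thesis by simp
      qed
      have dC: "v - Q *\<^sub>v v \<in> carrier_vec n" using Q v by simp
      have u0: "(v - Q *\<^sub>v v) \<bullet> u = 0"
      proof (cases "u \<bullet> u = 0")
        case True
        then have "u = 0\<^sub>v n"
          using conjugate_square_eq_0_vec[OF u, unfolded vec_conjugate_real] by blast
        then show ?thesis using scalar_prod_right_zero[OF dC] by (simp only:)
      next
        case False
        have "?r \<bullet> u = u \<bullet> v - u \<bullet> (P *\<^sub>v v)"
          using minus_scalar_prod_distrib[OF v PvC[OF v] u]
            comm_scalar_prod[OF v u] comm_scalar_prod[OF PvC[OF v] u] by (simp only:)
        moreover have "c * (u \<bullet> v) * (u \<bullet> u) = u \<bullet> v"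
          using False by (simp add: c_def)
        ultimately show ?thesis using prod[OF u] uo[OF Pv[OF v]] by linarith
      qed
      have "(v - Q *\<^sub>v v) \<bullet> w = 0"
      proof -
        have "a = a - b + b" if "a \<in> carrier_vec n" "b \<in> carrier_vec n" for a b :: "real vec"
          using that by (intro eq_vecI) auto
        then have "w = u + P *\<^sub>v w" unfolding u_def using w PvC[OF w] by blast
        then have "(v - Q *\<^sub>v v) \<bullet> w = (v - Q *\<^sub>v v) \<bullet> (u + P *\<^sub>v w)"
          by (rule arg_cong)
        also have "\<dots> = (v - Q *\<^sub>v v) \<bullet> u + (v - Q *\<^sub>v v) \<bullet> (P *\<^sub>v w)"
          by (rule scalar_prod_add_distrib[OF dC u PvC[OF w]])
        finally show ?thesis using u0 cs0[OF Pv[OF w]] by simp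
      qed
      then have "v - Q *\<^sub>v v \<in> V.orthogonal_complement (set (w # cs))"
        using cs0 V.in_own_span[OF cs] dC unfolding V.orthogonal_complement_def by auto
      then show "v - Q *\<^sub>v v \<in> V.orthogonal_complement ?W"
        using V.in_orthogonal_complement_span[OF ws] by simp
    qed
    then show ?case using Q by blast
  qed
  then show ?thesis
    unfolding is_orth_proj_mat_def V.col_space_def using cols_mat_of_cols[OF assms] by auto
qed

lemma orth_proj_mat_unique:
  assumes sub: "W \<subseteq> carrier_vec n"
    and P: "is_orth_proj_mat n W P" and Q: "is_orth_proj_mat n W Q"
  shows "P = Q"
proof -
  interpret V: vec_space "TYPE(real)" n .
  have PC: "P \<in> carrier_mat n n" and QC: "Q \<in> carrier_mat n n"
    using P Q by (auto simp: is_orth_proj_mat_def)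
  have "P *\<^sub>v v = Q *\<^sub>v v" if v: "v \<in> carrier_vec n" for v
  proof -
    let ?a = "P *\<^sub>v v" and ?b = "Q *\<^sub>v v"
    have W: "?a \<in> W" "?b \<in> W" using P Q v by (auto simp: is_orth_proj_mat_def)
    then have C: "?a \<in> carrier_vec n" "?b \<in> carrier_vec n" using sub by auto
    have o: "(v - ?a) \<bullet> y = 0" "(v - ?b) \<bullet> y = 0" if "y \<in> W" for y
      using P Q v that by (auto simp: is_orth_proj_mat_def V.orthogonal_complement_def)
    have d: "(?a - ?b) \<bullet> y = 0" if "y \<in> W" for y
    proof -
      have y: "y \<in> carrier_vec n" using that sub by auto
      show ?thesis
        using o[OF that] minus_scalar_prod_distrib[OF v C(1) y]
          minus_scalar_prod_distrib[OF v C(2) y] minus_scalar_prod_distrib[OF C y] by simp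
    qed
    have dC: "?a - ?b \<in> carrier_vec n" using C by simp
    have "(?a - ?b) \<bullet> (?a - ?b) = 0"
      using scalar_prod_minus_distrib[OF dC C] d W by simp
    then have "?a - ?b = 0\<^sub>v n"
      using conjugate_square_eq_0_vec[OF dC, unfolded vec_conjugate_real] by blast
    then have z: "(?a - ?b) $ i = 0\<^sub>v n $ i" for i
      by simp
    show ?thesis
    proof (rule eq_vecI)
      fix i assume "i < dim_vec ?b"
      then have "i < n" using carrier_vecD[OF C(2)] by simp
      then show "?a $ i = ?b $ i"
        using z[of i] index_minus_vec(1)[of i ?b ?a, OF \<open>i < dim_vec ?b\<close>] index_zero_vec(1)[of i n]
        by (metis eq_iff_diff_eq_0)
    qed (simp only: carrier_vecD[OF C(1)] carrier_vecD[OF C(2)])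
  qed
  then have eq: "(P *\<^sub>v unit_vec n j) $ i = (Q *\<^sub>v unit_vec n j) $ i" for i j
    by (metis unit_vec_carrier)
  show ?thesis
  proof (rule eq_matI)
    fix i j assume "i < dim_row Q" "j < dim_col Q"
    then have ij: "i < n" "j < n" using QC by auto
    have "(A *\<^sub>v unit_vec n j) $ i = A $$ (i, j)" if "A \<in> carrier_mat n n" for A :: "real mat"
      using that ij by simp
    then show "P $$ (i, j) = Q $$ (i, j)"
      using eq[of j i] PC QC by metis
  qed (use PC QC in auto)
qed

lemma hat_matrix_ex1:
  "\<exists>!P. is_orth_proj_mat n (vec_space.col_space n (design_matrix n x s)) P"
proof -
  interpret V: vec_space "TYPE(real)" n .
  have cols: "set (model_cols n x s) \<subseteq> carrier_vec n"
    by (auto simp: model_cols_def)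
  have "V.col_space (design_matrix n x s) \<subseteq> carrier_vec n"
    unfolding V.col_space_def design_matrix_def cols_mat_of_cols[OF cols]
    using V.span_closed[of "set (model_cols n x s)"] cols by auto
  then show ?thesis
    using orth_proj_mat_exists[OF cols] orth_proj_mat_unique unfolding design_matrix_def by blast
qed

end

theory Submission
  imports Defs
begin

text \<open>
  With \<open>\<epsilon> = \<sigma> w\<close> one has
  \<open>RSS(s) = \<Delta>(s) + 2\<sigma> r(s)\<^sup>T w + \<sigma>\<^sup>2 (w\<^sup>T w - w\<^sup>T H(s) w)\<close> with \<open>r(s) = \<mu> - H(s) \<mu>\<close>. Chernoff bounds,
  summed over models with weights \<open>p\<close> to the power \<open>-k(s)\<close> (whose total is at most \<open>e\<close>), show that with
  high probability \<open>w\<^sup>T H(s) w = O(p\<^sub>0 ln p)\<close> and \<open>-r(s)\<^sup>T w \<le> \<Delta>(s) / (4\<sigma>) + O(p\<^sub>0 ln p)\<close> uniformly in \<open>s\<close>. If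
  \<open>s\<close> misses a true predictor, \<open>RSS(s) - RSS(s\<^sub>0)\<close> thus exceeds any multiple of \<open>p\<^sub>0 ln p\<close>, which beats the
  penalties. If \<open>s\<close> contains \<open>s\<^sub>0\<close> and \<open>m \<ge> 1\<close> further predictors, the drop in RSS divided by \<open>\<sigma>\<^sup>2\<close> is
  chi-squared with at most \<open>m\<close> degrees of freedom; uniformly over such \<open>s\<close> it stays below \<open>m \<tau>\<close> with
  \<open>\<tau> = 2 ln p + (1-\<alpha>)/2 ln n + ln ln p\<close>. The growth conditions make the penalty exceed \<open>m \<tau>\<close>, because
  \<open>2 ln (k p\<^sub>0) \<le> \<alpha> ln n - ln ln p + O(1)\<close>.
\<close>

section \<open>Hat matrices and residual sums of squares\<close>

lemma orth_complement_ip: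
  "v \<in> vec_module.orthogonal_complement n W \<Longrightarrow> y \<in> W \<Longrightarrow> v \<bullet> y = (0::real)"
  "v \<in> vec_module.orthogonal_complement n W \<Longrightarrow> v \<in> carrier_vec n"
  by (auto simp: vec_module.orthogonal_complement_def)

lemma self_ip_eq_0_iff:
  fixes u :: "real vec"
  assumes "u \<in> carrier_vec n"
  shows "u \<bullet> u = 0 \<longleftrightarrow> u = 0\<^sub>v n"
  using conjugate_square_eq_0_vec[OF assms, unfolded vec_conjugate_real] .

lemma self_ip_nonneg: "(u :: real vec) \<bullet> u \<ge> 0"
  by (simp add: scalar_prod_def sum_nonneg)

text \<open>Subtracting the two orthogonality relations makes \<open>a - b\<close> orthogonal to
  \<open>W\<close>, in particular to \<open>a\<close> and to \<open>b\<close>, so its norm is zero.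
  This identifies a projection with a guessed value.\<close>

lemma orth_proj_unique_vec:
  fixes a b v :: "real vec"
  assumes W: "a \<in> W" "b \<in> W" "W \<subseteq> carrier_vec n" and v: "v \<in> carrier_vec n"
    and "\<And>y. y \<in> W \<Longrightarrow> (v - a) \<bullet> y = 0" "\<And>y. y \<in> W \<Longrightarrow> (v - b) \<bullet> y = 0"
  shows "a = b"
proof -
  have a: "a \<in> carrier_vec n" and b: "b \<in> carrier_vec n" using W by auto
  have *: "(a - b) \<bullet> y = 0" if "y \<in> W" for y
  proof -
    have y: "y \<in> carrier_vec n" using that W by auto
    show ?thesis
      using assms(5,6)[OF that] minus_scalar_prod_distrib[OF v a y]
        minus_scalar_prod_distrib[OF v b y] minus_scalar_prod_distrib[OF a b y] by simp
  qed
  have "(a - b) \<bullet> (a - b) = (a - b) \<bullet> a - (a - b) \<bullet> b"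
    using a b by (intro scalar_prod_minus_distrib) auto
  then have "(a - b) \<bullet> (a - b) = 0" using * W by simp
  then have z: "a - b = 0\<^sub>v n" using self_ip_eq_0_iff[of "a - b" n] a b by simp
  show ?thesis
  proof (rule eq_vecI)
    fix i assume "i < dim_vec b"
    moreover have "(a - b) $ i = 0\<^sub>v n $ i" using z by simp
    ultimately show "a $ i = b $ i" using a b by auto
  qed (use a b in auto)
qed

text \<open>A list, so that vectors can be peeled off one at a time in inductions;
  \<open>sorted_wrt\<close> tests earlier against later vectors only, which suffices because the
  scalar product is symmetric.\<close>

definition orthonormal_list :: "nat \<Rightarrow> real vec list \<Rightarrow> bool" where
  "orthonormal_list n us \<longleftrightarrow> set us \<subseteq> carrier_vec n \<and> (\<forall>u\<in>set us. u \<bullet> u = 1)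
     \<and> sorted_wrt (\<lambda>u v. u \<bullet> v = 0) us"

lemma orthonormal_list_Nil [simp]: "orthonormal_list n []"
  by (simp add: orthonormal_list_def)

lemma orthonormal_list_Cons:
  "orthonormal_list n (u # us) \<longleftrightarrow>
     u \<in> carrier_vec n \<and> u \<bullet> u = 1 \<and> (\<forall>v\<in>set us. u \<bullet> v = 0) \<and> orthonormal_list n us"
  by (auto simp: orthonormal_list_def)

text \<open>Gram-Schmidt: each added column contributes its normalised residual as a new unit
  vector, or nothing if it depends linearly on the columns already present; hence only an inequality
  between the lengths. Recording that \<open>us\<close> lies in the column space makes the next
  residual orthogonal to all of \<open>us\<close>.\<close>

lemma orth_proj_quadratic_extend:
  assumes cs: "set cs \<subseteq> carrier_vec n" and "set ws \<subseteq> carrier_vec n"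
    and P: "is_orth_proj_mat n (vec_space.col_space n (mat_of_cols n cs)) P"
    and "is_orth_proj_mat n (vec_space.col_space n (mat_of_cols n (ws @ cs))) Q"
  shows "\<exists>us. orthonormal_list n us
      \<and> set us \<subseteq> vec_space.col_space n (mat_of_cols n (ws @ cs)) \<and> length us \<le> length ws
      \<and> (\<forall>v\<in>carrier_vec n. v \<bullet> (Q *\<^sub>v v) = v \<bullet> (P *\<^sub>v v) + (\<Sum>u\<leftarrow>us. (u \<bullet> v)\<^sup>2))"
  using assms(2,4)
proof (induction ws arbitrary: Q)
  case Nil
  interpret V: vec_space "TYPE(real)" n .
  have "V.col_space (mat_of_cols n cs) \<subseteq> carrier_vec n"
    unfolding V.col_space_def cols_mat_of_cols[OF cs] using V.span_closed[OF cs] by auto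
  then have "Q = P" using orth_proj_mat_unique P Nil by simp
  then show ?case by (intro exI[of _ "[]"]) auto
next
  case (Cons w ws)
  interpret V: vec_space "TYPE(real)" n .
  let ?C = "set (ws @ cs)"
  have w: "w \<in> carrier_vec n" and C: "?C \<subseteq> carrier_vec n" and C': "set (w # ws @ cs) \<subseteq> carrier_vec n"
    using Cons.prems cs by auto
  have col: "V.col_space (mat_of_cols n (ws @ cs)) = V.span ?C"
    "V.col_space (mat_of_cols n ((w # ws) @ cs)) = V.span (insert w ?C)"
    unfolding V.col_space_def using cols_mat_of_cols[OF C] cols_mat_of_cols[OF C'] by simp_all
  obtain P' where P': "is_orth_proj_mat n (V.span ?C) P'"
    using orth_proj_mat_exists[OF C] unfolding col by blast
  obtain us where us: "orthonormal_list n us" "set us \<subseteq> V.span ?C" "length us \<le> length ws"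
    and usq: "\<And>v. v \<in> carrier_vec n \<Longrightarrow>
      v \<bullet> (P' *\<^sub>v v) = v \<bullet> (P *\<^sub>v v) + (\<Sum>u\<leftarrow>us. (u \<bullet> v)\<^sup>2)"
    using Cons.IH[of P'] Cons.prems P' unfolding col by auto
  let ?W = "V.span (insert w ?C)"
  have Q: "is_orth_proj_mat n ?W Q" using Cons.prems col by simp
  have WC: "?W \<subseteq> carrier_vec n" using V.span_closed[of "insert w ?C"] C w by auto
  have WC0: "V.span ?C \<subseteq> carrier_vec n" using V.span_closed[OF C] by auto
  have insC: "insert w ?C \<subseteq> carrier_vec n" using C w by auto
  have sub: "V.span ?C \<subseteq> ?W" by (rule V.span_is_monotone) auto
  have wW: "w \<in> ?W" using V.in_own_span[OF insC] by auto
  have Qv: "Q *\<^sub>v v \<in> ?W" "Q *\<^sub>v v \<in> carrier_vec n" "\<And>y. y \<in> ?W \<Longrightarrow> (v - Q *\<^sub>v v) \<bullet> y = 0"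
    if "v \<in> carrier_vec n" for v
    using Q that WC orth_complement_ip unfolding is_orth_proj_mat_def by blast+
  have Pv: "P' *\<^sub>v v \<in> V.span ?C" "P' *\<^sub>v v \<in> carrier_vec n"
    "\<And>y. y \<in> V.span ?C \<Longrightarrow> (v - P' *\<^sub>v v) \<bullet> y = 0" if "v \<in> carrier_vec n" for v
    using P' that WC0 orth_complement_ip unfolding is_orth_proj_mat_def by blast+
  have Pd: "dim_row P' = n" using P' by (auto simp: is_orth_proj_mat_def)
  have orth_WI: "x \<bullet> y = 0" if "x \<in> carrier_vec n" "\<And>y. y \<in> V.span ?C \<Longrightarrow> x \<bullet> y = 0" "x \<bullet> w = 0"
    "y \<in> ?W" for x y
  proof -
    have "x \<in> V.orthogonal_complement (insert w ?C)"
      using that V.in_own_span[OF C] by (auto simp: V.orthogonal_complement_def)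
    then have "x \<in> V.orthogonal_complement ?W" using insC by simp
    then show ?thesis using that(4) orth_complement_ip by blast
  qed
  define u where "u = w - P' *\<^sub>v w"
  have uC: "u \<in> carrier_vec n" unfolding u_def using w Pv(2)[OF w] by simp
  have uo: "u \<bullet> y = 0" if "y \<in> V.span ?C" for y unfolding u_def using Pv(3)[OF w that] .
  have wu: "w = u + P' *\<^sub>v w" unfolding u_def using w Pv(2)[OF w] by (intro eq_vecI) (auto simp: Pd)
  \<comment> \<open>Modulo the old span, \<open>w\<close> and its residual \<open>u\<close>
    coincide, so tests against \<open>w\<close> reduce to tests against \<open>u\<close>.\<close>
  have ip_w: "x \<bullet> w = x \<bullet> u" if "x \<in> carrier_vec n" "\<And>y. y \<in> V.span ?C \<Longrightarrow> x \<bullet> y = 0" for x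
  proof -
    have "x \<bullet> w = x \<bullet> (u + P' *\<^sub>v w)" using wu by simp
    also have "\<dots> = x \<bullet> u + x \<bullet> (P' *\<^sub>v w)"
      by (rule scalar_prod_add_distrib[OF that(1) uC Pv(2)[OF w]])
    finally show ?thesis using that(2)[OF Pv(1)[OF w]] by simp
  qed
  have uW: "u \<in> ?W"
  proof -
    have "u = w + (-1) \<cdot>\<^sub>v (P' *\<^sub>v w)"
      unfolding u_def using w Pv(2)[OF w] by (intro eq_vecI) (auto simp: Pd)
    moreover have "(-1) \<cdot>\<^sub>v (P' *\<^sub>v w) \<in> ?W"
      by (rule V.smult_in_span[OF insC subsetD[OF sub Pv(1)[OF w]]])
    ultimately show ?thesis using V.span_add1[OF insC wW] by simp
  qed
  show ?case
  proof (cases "u = 0\<^sub>v n")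
    \<comment> \<open>The new column already lies in the old span, so the projection does not
      change.\<close>
    case True
    have "v \<bullet> (Q *\<^sub>v v) = v \<bullet> (P' *\<^sub>v v)" if v: "v \<in> carrier_vec n" for v
    proof -
      have d: "v - P' *\<^sub>v v \<in> carrier_vec n" using v Pv(2) by simp
      have "(v - P' *\<^sub>v v) \<bullet> w = (v - P' *\<^sub>v v) \<bullet> 0\<^sub>v n"
        using ip_w[OF d Pv(3)[OF v]] True by simp
      then have "(v - P' *\<^sub>v v) \<bullet> w = 0"
        using scalar_prod_right_zero[OF d] by simp
      then have "(v - P' *\<^sub>v v) \<bullet> y = 0" if "y \<in> ?W" for y
        using orth_WI[OF d Pv(3)[OF v]] that by blast
      then have "Q *\<^sub>v v = P' *\<^sub>v v"
        using orth_proj_unique_vec[OF Qv(1)[OF v] subsetD[OF sub Pv(1)[OF v]] WC v Qv(3)[OF v]]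
        by blast
      then show ?thesis by simp
    qed
    then show ?thesis using us usq sub col by (intro exI[of _ us]) auto
  next
    case False
    define c where "c = 1 / sqrt (u \<bullet> u)"
    have upos: "u \<bullet> u > 0" using False self_ip_eq_0_iff[OF uC] self_ip_nonneg[of u] by auto
    define e where "e = c \<cdot>\<^sub>v u"
    have eC: "e \<in> carrier_vec n" and eW: "e \<in> ?W"
      unfolding e_def using uC V.smult_in_span[OF insC uW] by auto
    have e_ip: "e \<bullet> y = c * (u \<bullet> y)" "y \<bullet> e = c * (u \<bullet> y)" if "y \<in> carrier_vec n" for y
      unfolding e_def using uC that by (auto simp: comm_scalar_prod[OF that uC])
    have eo: "e \<bullet> y = 0" if "y \<in> V.span ?C" for y
      using e_ip(1)[of y] uo[OF that] WC0 that by auto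
    have c2: "c * c * (u \<bullet> u) = 1" using upos by (simp add: c_def)
    have ee: "e \<bullet> e = 1" using e_ip(1)[OF eC] e_ip(2)[OF uC] c2 comm_scalar_prod[OF uC eC] by simp
    have eu: "e \<bullet> u = c * (u \<bullet> u)" using e_ip uC by simp
    have "v \<bullet> (Q *\<^sub>v v) = v \<bullet> (P' *\<^sub>v v) + (e \<bullet> v)\<^sup>2" if v: "v \<in> carrier_vec n" for v
    proof -
      \<comment> \<open>Candidate for \<open>Q *\<^sub>v v\<close>: it lies in the new span, and its
        residual is orthogonal to the old span and to \<open>e\<close>, hence to \<open>w\<close>;
        uniqueness does the rest.\<close>
      let ?b = "P' *\<^sub>v v + (e \<bullet> v) \<cdot>\<^sub>v e"
      have sC: "(e \<bullet> v) \<cdot>\<^sub>v e \<in> carrier_vec n" using eC by simp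
      have bC: "?b \<in> carrier_vec n" using Pv(2)[OF v] sC by simp
      have rC: "v - P' *\<^sub>v v \<in> carrier_vec n" using v Pv(2)[OF v] by simp
      have dC: "v - ?b \<in> carrier_vec n" using v bC by simp
      have d_eq: "v - ?b = (v - P' *\<^sub>v v) - (e \<bullet> v) \<cdot>\<^sub>v e"
        using v Pv(2)[OF v] eC by (intro eq_vecI) (auto simp: Pd)
      have d_ip: "(v - ?b) \<bullet> y = (v - P' *\<^sub>v v) \<bullet> y - (e \<bullet> v) * (e \<bullet> y)" if y: "y \<in> carrier_vec n" for y
        unfolding d_eq minus_scalar_prod_distrib[OF rC sC y] using eC y by simp
      have d0: "(v - ?b) \<bullet> y = 0" if "y \<in> V.span ?C" for y
        using d_ip[of y] WC0 that Pv(3)[OF v that] eo[OF that] by auto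
      have ve: "(v - P' *\<^sub>v v) \<bullet> e = e \<bullet> v"
        using minus_scalar_prod_distrib[OF v Pv(2)[OF v] eC] eo[OF Pv(1)[OF v]]
          comm_scalar_prod[OF v eC] comm_scalar_prod[OF Pv(2)[OF v] eC] by simp
      have "(v - ?b) \<bullet> e = 0" using d_ip[OF eC] ee ve by simp
      moreover have "(v - ?b) \<bullet> e = c * ((v - ?b) \<bullet> u)" 
        unfolding e_def using scalar_prod_smult_distrib[OF dC uC] by simp
      moreover have "c \<noteq> 0" using upos by (simp add: c_def)
      ultimately have "(v - ?b) \<bullet> u = 0" by simp
      then have "(v - ?b) \<bullet> w = 0" using ip_w[OF dC d0] by simp
      then have "(v - ?b) \<bullet> y = 0" if "y \<in> ?W" for y using orth_WI[OF dC d0] that by blast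
      moreover have "?b \<in> ?W"
        using V.span_add1[OF insC subsetD[OF sub Pv(1)[OF v]] V.smult_in_span[OF insC eW]] .
      ultimately have "Q *\<^sub>v v = ?b"
        using orth_proj_unique_vec[OF Qv(1)[OF v] \<open>?b \<in> ?W\<close> WC v Qv(3)[OF v]] by blast
      then have "v \<bullet> (Q *\<^sub>v v) = v \<bullet> ?b" by simp
      also have "\<dots> = v \<bullet> (P' *\<^sub>v v) + v \<bullet> ((e \<bullet> v) \<cdot>\<^sub>v e)"
        by (rule scalar_prod_add_distrib[OF v Pv(2)[OF v] sC])
      also have "v \<bullet> ((e \<bullet> v) \<cdot>\<^sub>v e) = (e \<bullet> v)\<^sup>2"
        using scalar_prod_smult_distrib[OF v eC] comm_scalar_prod[OF v eC] by (simp add: power2_eq_square)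
      finally show ?thesis .
    qed
    moreover have "orthonormal_list n (e # us)"
      using us eC ee eo by (auto simp: orthonormal_list_Cons)
    ultimately show ?thesis using us usq sub col eW
      by (intro exI[of _ "e # us"]) auto
  qed
qed


section \<open>Hat matrices of nested models\<close>

definition hat_quad :: "nat \<Rightarrow> (nat \<Rightarrow> nat \<Rightarrow> real) \<Rightarrow> nat set \<Rightarrow> real vec \<Rightarrow> real" where
  "hat_quad n x s v = v \<bullet> (hat_matrix n x s *\<^sub>v v)"

abbreviation model_space :: "nat \<Rightarrow> (nat \<Rightarrow> nat \<Rightarrow> real) \<Rightarrow> nat set \<Rightarrow> real vec set" where
  "model_space n x s \<equiv> vec_space.col_space n (design_matrix n x s)"

lemma model_cols_carrier: "set (model_cols n x s) \<subseteq> carrier_vec n"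
  by (auto simp: model_cols_def)

text \<open>Finiteness is assumed because \<open>sorted_list_of_set\<close> returns the empty list
  on infinite sets.\<close>

lemma model_space_mono:
  assumes "s0 \<subseteq> s" "finite s"
  shows "model_space n x s0 \<subseteq> model_space n x s"
proof -
  interpret V: vec_space "TYPE(real)" n .
  have f: "finite s0" using assms finite_subset by blast
  show ?thesis
    unfolding design_matrix_def V.col_space_def cols_mat_of_cols[OF model_cols_carrier]
    by (rule V.span_is_monotone) (use assms f in \<open>auto simp: model_cols_def\<close>)
qed

lemma model_space_carrier: "model_space n x s \<subseteq> carrier_vec n"
proof -
  interpret V: vec_space "TYPE(real)" n .
  show ?thesis
    unfolding design_matrix_def V.col_space_def cols_mat_of_cols[OF model_cols_carrier]
    using V.span_closed[OF model_cols_carrier] by blast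
qed

lemma hat_matrix_orth_proj: "is_orth_proj_mat n (model_space n x s) (hat_matrix n x s)"
  unfolding hat_matrix_def by (rule theI'[OF hat_matrix_ex1])

lemma hat_matrix_mult:
  assumes "v \<in> carrier_vec n"
  shows "hat_matrix n x s *\<^sub>v v \<in> model_space n x s"
    and "hat_matrix n x s *\<^sub>v v \<in> carrier_vec n"
    and "\<And>y. y \<in> model_space n x s \<Longrightarrow> (v - hat_matrix n x s *\<^sub>v v) \<bullet> y = 0"
  using hat_matrix_orth_proj[of n x s] assms model_space_carrier orth_complement_ip
  unfolding is_orth_proj_mat_def by blast+

lemma hat_matrix_carrier: "hat_matrix n x s \<in> carrier_mat n n"
  using hat_matrix_orth_proj[of n x s] by (simp add: is_orth_proj_mat_def)

lemma hat_quad_extend: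
  assumes "s0 \<subseteq> s" "finite s"
  shows "\<exists>us. orthonormal_list n us \<and> length us \<le> card (s - s0)
    \<and> (\<forall>v\<in>carrier_vec n. hat_quad n x s v = hat_quad n x s0 v + (\<Sum>u\<leftarrow>us. (u \<bullet> v)\<^sup>2))"
proof -
  interpret V: vec_space "TYPE(real)" n .
  define ws where "ws = map (\<lambda>j. vec n (\<lambda>i. x (Suc i) j)) (sorted_list_of_set (s - s0))"
  have f: "finite s0" using assms finite_subset by blast
  have ws: "set ws \<subseteq> carrier_vec n" by (auto simp: ws_def)
  have c: "set (ws @ model_cols n x s0) \<subseteq> carrier_vec n" using ws model_cols_carrier by auto
  \<comment> \<open>The columns come in another order than in \<open>model_cols n x s\<close>, but
    the column space depends only on their set.\<close>
  have "set (ws @ model_cols n x s0) = set (model_cols n x s)"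
    using assms f by (auto simp: ws_def model_cols_def)
  then have "V.col_space (mat_of_cols n (ws @ model_cols n x s0)) = model_space n x s"
    unfolding design_matrix_def V.col_space_def cols_mat_of_cols[OF model_cols_carrier]
      cols_mat_of_cols[OF c] by simp
  then have "is_orth_proj_mat n (V.col_space (mat_of_cols n (ws @ model_cols n x s0))) (hat_matrix n x s)"
    using hat_matrix_orth_proj by simp
  from orth_proj_quadratic_extend[OF model_cols_carrier ws
      hat_matrix_orth_proj[of n x s0, unfolded design_matrix_def] this]
  show ?thesis unfolding hat_quad_def by (auto simp: ws_def)
qed

text \<open>Extension from the empty list of columns, whose projection is zero; the
  \<open>+ 1\<close> accounts for the intercept.\<close>

lemma hat_quad_eq_sum:
  assumes "finite s"
  shows "\<exists>us. orthonormal_list n us \<and> length us \<le> card s + 1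
    \<and> (\<forall>v\<in>carrier_vec n. hat_quad n x s v = (\<Sum>u\<leftarrow>us. (u \<bullet> v)\<^sup>2))"
proof -
  interpret V: vec_space "TYPE(real)" n .
  obtain P where P: "is_orth_proj_mat n (V.col_space (mat_of_cols n [])) P"
    using orth_proj_mat_exists[of "[]" n] by auto
  have "v \<bullet> (P *\<^sub>v v) = 0" if v: "v \<in> carrier_vec n" for v
  proof -
    have "P *\<^sub>v v \<in> V.span {}"
      using P v cols_mat_of_cols[of "[]" n] unfolding is_orth_proj_mat_def V.col_space_def by auto
    then have "P *\<^sub>v v = 0\<^sub>v n" using V.span_empty by simp
    then show ?thesis using scalar_prod_right_zero[OF v] by simp
  qed
  moreover have "is_orth_proj_mat n (V.col_space (mat_of_cols n (model_cols n x s @ []))) (hat_matrix n x s)"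
    using hat_matrix_orth_proj by (simp add: design_matrix_def)
  note orth_proj_quadratic_extend[OF _ model_cols_carrier P this]
  moreover have "length (model_cols n x s) = card s + 1" by (simp add: model_cols_def)
  ultimately show ?thesis unfolding hat_quad_def by auto
qed

section \<open>The mean vector, its bias and the residual sum of squares\<close>

lemma mat_of_cols_map_mult_vec:
  fixes g :: "'b \<Rightarrow> real"
  assumes "i < n" "\<And>j. f j \<in> carrier_vec n"
  shows "(mat_of_cols n (map f js) *\<^sub>v vec_of_list (map g js)) $ i = (\<Sum>j\<leftarrow>js. f j $ i * g j)"
proof -
  have "(mat_of_cols n (map f js) *\<^sub>v vec_of_list (map g js)) $ i
      = (\<Sum>l = 0..<length js. f (js ! l) $ i * g (js ! l))"
    using assms by (simp add: scalar_prod_def vec_of_list_index mat_of_cols_index)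
  then show ?thesis by (simp add: sum_list_sum_nth)
qed

lemma mean_vec_carrier: "mean_vec n p x \<beta> \<in> carrier_vec n"
  unfolding mean_vec_def design_matrix_def by (simp add: carrier_vecI)

lemma mean_vec_index:
  assumes "i < n"
  shows "mean_vec n p x \<beta> $ i = \<beta> 0 + (\<Sum>j = 1..p. \<beta> j * x (Suc i) j)"
proof -
  let ?t = "true_model p \<beta>"
  \<comment> \<open>Treating the intercept as column \<open>0\<close> turns columns and coefficients
    into images of one index list.\<close>
  define f where "f j = vec n (\<lambda>i. if j = 0 then 1 else x (Suc i) j)" for j :: nat
  have t: "finite ?t" "0 \<notin> ?t" by (auto simp: true_model_def)
  have "model_cols n x ?t = map f (0 # sorted_list_of_set ?t)"
    using t by (auto simp: model_cols_def f_def)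
  then have "mean_vec n p x \<beta> $ i = (\<Sum>j\<leftarrow>0 # sorted_list_of_set ?t. f j $ i * \<beta> j)"
    unfolding mean_vec_def design_matrix_def coef_vec_def
    using mat_of_cols_map_mult_vec[OF assms, of f "0 # sorted_list_of_set ?t" \<beta>] by (simp add: f_def)
  also have "\<dots> = \<beta> 0 + (\<Sum>j\<in>?t. f j $ i * \<beta> j)"
    using assms t by (simp add: f_def sum_list_distinct_conv_sum_set)
  also have "(\<Sum>j\<in>?t. f j $ i * \<beta> j) = (\<Sum>j = 1..p. \<beta> j * x (Suc i) j)"
    using assms t by (intro sum.mono_neutral_cong_left) (auto simp: true_model_def f_def)
  finally show ?thesis .
qed

lemma response_eq_mean_vec_plus:
  "response n p x \<beta> e = mean_vec n p x \<beta> + vec n (\<lambda>i. e (Suc i))"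
  using mean_vec_carrier[of n p x \<beta>]
  by (intro eq_vecI) (auto simp: response_def mean_vec_index)

lemma mean_vec_in_model_space: "mean_vec n p x \<beta> \<in> model_space n x (true_model p \<beta>)"
proof -
  interpret V: vec_space "TYPE(real)" n .
  let ?X = "design_matrix n x (true_model p \<beta>)" and ?b = "coef_vec \<beta> (true_model p \<beta>)"
  have X: "?X \<in> carrier_mat n (dim_col ?X)" by (auto simp: design_matrix_def)
  have "?b \<in> carrier_vec (dim_col ?X)"
    by (intro carrier_vecI) (simp add: coef_vec_def design_matrix_def model_cols_def)
  moreover have "?X *\<^sub>v ?b \<in> carrier_vec (dim_row ?X)" by (simp add: carrier_vecI)
  ultimately show ?thesis
    unfolding V.col_space_eq[OF X] mean_vec_def by blast
qed

definition gap_vec where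
  "gap_vec n p x \<beta> s = mean_vec n p x \<beta> - hat_matrix n x s *\<^sub>v mean_vec n p x \<beta>"

lemma gap_vec_carrier: "gap_vec n p x \<beta> s \<in> carrier_vec n"
  unfolding gap_vec_def using mean_vec_carrier hat_matrix_mult(2)[OF mean_vec_carrier] by simp

lemma model_gap_eq: "model_gap n p x \<beta> s = gap_vec n p x \<beta> s \<bullet> gap_vec n p x \<beta> s"
  by (simp add: model_gap_def gap_vec_def Let_def)

text \<open>A model containing the true one has the mean in its column space, where the projection
  is the identity: such models are unbiased.\<close>

lemma gap_vec_eq_0:
  assumes "true_model p \<beta> \<subseteq> s" "finite s"
  shows "gap_vec n p x \<beta> s = 0\<^sub>v n"
proof -
  let ?\<mu> = "mean_vec n p x \<beta>"
  have "?\<mu> \<in> model_space n x s"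
    using mean_vec_in_model_space model_space_mono[OF assms] by blast
  moreover have "(?\<mu> - ?\<mu>) \<bullet> y = 0" if "y \<in> model_space n x s" for y
    using mean_vec_carrier[of n p x \<beta>] model_space_carrier[of n x s] that by auto
  ultimately have "hat_matrix n x s *\<^sub>v ?\<mu> = ?\<mu>"
    using orth_proj_unique_vec[OF hat_matrix_mult(1)[OF mean_vec_carrier] _ model_space_carrier mean_vec_carrier
      hat_matrix_mult(3)[OF mean_vec_carrier]] by blast
  then show ?thesis unfolding gap_vec_def using mean_vec_carrier[of n p x \<beta>] by simp
qed

text \<open>The residual of mean plus noise is \<open>?r + q\<close>, bias plus noise residual, both
  orthogonal to the model space. In scalar products with either, the mean may be replaced by
  \<open>?r\<close> and the noise by \<open>q\<close>.\<close>

lemma RSS_decomp: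
  assumes e: "e \<in> carrier_vec n"
  shows "RSS n x (mean_vec n p x \<beta> + e) s
    = model_gap n p x \<beta> s + 2 * (gap_vec n p x \<beta> s \<bullet> e) + e \<bullet> e - hat_quad n x s e"
proof -
  let ?\<mu> = "mean_vec n p x \<beta>" and ?H = "hat_matrix n x s" and ?r = "gap_vec n p x \<beta> s"
  have m: "?\<mu> \<in> carrier_vec n" by (rule mean_vec_carrier)
  have H: "?H \<in> carrier_mat n n" by (rule hat_matrix_carrier)
  have He: "?H *\<^sub>v e \<in> carrier_vec n" and Hm: "?H *\<^sub>v ?\<mu> \<in> carrier_vec n"
    using hat_matrix_mult(2) e m by auto
  define q where "q = e - ?H *\<^sub>v e"
  have q: "q \<in> carrier_vec n" unfolding q_def using e He by simp
  have r: "?r \<in> carrier_vec n" by (rule gap_vec_carrier)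
  have "(1\<^sub>m n - ?H) *\<^sub>v (?\<mu> + e) = (?\<mu> + e) - ?H *\<^sub>v (?\<mu> + e)"
    using minus_mult_distrib_mat_vec[of "1\<^sub>m n" n n ?H "?\<mu> + e"] H m e by simp
  also have "?H *\<^sub>v (?\<mu> + e) = ?H *\<^sub>v ?\<mu> + ?H *\<^sub>v e"
    by (rule mult_add_distrib_mat_vec[OF H m e])
  also have "(?\<mu> + e) - (?H *\<^sub>v ?\<mu> + ?H *\<^sub>v e) = ?r + q"
    unfolding gap_vec_def q_def using m e carrier_vecD[OF He] carrier_vecD[OF Hm]
    by (intro eq_vecI) (auto simp del: dim_mult_mat_vec index_mult_mat_vec)
  finally have *: "(1\<^sub>m n - ?H) *\<^sub>v (?\<mu> + e) = ?r + q" .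
  have mr: "?\<mu> = ?r + ?H *\<^sub>v ?\<mu>"
    unfolding gap_vec_def using m carrier_vecD[OF Hm]
    by (intro eq_vecI) (auto simp del: dim_mult_mat_vec index_mult_mat_vec)
  have eq: "e = q + ?H *\<^sub>v e"
    unfolding q_def using e carrier_vecD[OF He]
    by (intro eq_vecI) (auto simp del: dim_mult_mat_vec index_mult_mat_vec)
  have o: "?r \<bullet> y = 0" "q \<bullet> y = 0" if "y \<in> model_space n x s" for y
    using hat_matrix_mult(3)[OF m that] hat_matrix_mult(3)[OF e that]
    by (simp_all add: gap_vec_def q_def)
  have ore: "?r \<bullet> e = ?r \<bullet> q"
    using scalar_prod_add_distrib[OF r q He] o(1)[OF hat_matrix_mult(1)[OF e]] eq by simp
  have mm: "?\<mu> \<bullet> ?r = ?r \<bullet> ?r"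
    using scalar_prod_add_distrib[OF r r Hm] o(1)[OF hat_matrix_mult(1)[OF m]] mr
      comm_scalar_prod[OF m r] by simp
  have mq: "?\<mu> \<bullet> q = ?r \<bullet> q"
    using scalar_prod_add_distrib[OF q r Hm] o(2)[OF hat_matrix_mult(1)[OF m]] mr
      comm_scalar_prod[OF m q] comm_scalar_prod[OF r q] by simp
  have ee: "e \<bullet> q = e \<bullet> e - hat_quad n x s e"
    unfolding q_def hat_quad_def by (rule scalar_prod_minus_distrib[OF e e He])
  have "RSS n x (?\<mu> + e) s = ?\<mu> \<bullet> ?r + ?\<mu> \<bullet> q + (e \<bullet> ?r + e \<bullet> q)"
    unfolding RSS_def * using add_scalar_prod_distrib[OF m e add_carrier_vec[OF r q]]
      scalar_prod_add_distrib[OF m r q] scalar_prod_add_distrib[OF e r q] by simp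
  then show ?thesis
    using mm mq ee ore comm_scalar_prod[OF e r] by (simp add: model_gap_eq)
qed

lemma hat_quad_smult:
  assumes "v \<in> carrier_vec n"
  shows "hat_quad n x s (c \<cdot>\<^sub>v v) = c\<^sup>2 * hat_quad n x s v"
proof -
  have "hat_matrix n x s *\<^sub>v (c \<cdot>\<^sub>v v) = c \<cdot>\<^sub>v (hat_matrix n x s *\<^sub>v v)"
    by (rule mult_mat_vec[OF hat_matrix_carrier assms])
  then show ?thesis
    using assms hat_matrix_mult(2)[OF assms]
    unfolding hat_quad_def power2_eq_square by (simp only:) simp
qed

section \<open>Quadratic forms in independent standard normal variables\<close>

text \<open>Completing the square with \<open>v = 1 - 2 * c\<close> turns the integrand into a
  constant times the normal density with mean \<open>b / v\<close> and variance
  \<open>1 / v\<close>.\<close>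

lemma nn_integral_std_normal_exp_quadratic:
  assumes c: "2 * c < 1"
  shows "(\<integral>\<^sup>+z. ennreal (std_normal_density z) * ennreal (exp (b * z + c * z\<^sup>2)) \<partial>lborel)
    = ennreal (exp (b\<^sup>2 / (2 * (1 - 2 * c))) / sqrt (1 - 2 * c))"
proof -
  define v where "v = 1 - 2 * c"
  have v: "v > 0" using c by (simp add: v_def)
  have eq: "std_normal_density z * exp (b * z + c * z\<^sup>2)
    = exp (b\<^sup>2 / (2 * v)) / sqrt v * normal_density (b / v) (1 / sqrt v) z" for z
  proof -
    have "- z\<^sup>2 / 2 + (b * z + c * z\<^sup>2) = b\<^sup>2 / (2 * v) + - (z - b / v)\<^sup>2 / (2 * (1 / sqrt v)\<^sup>2)"
    proof -
      have "(1 / sqrt v)\<^sup>2 = 1 / v" using v by (simp add: power_divide)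
      moreover have c: "c = (1 - v) / 2" by (simp add: v_def)
      ultimately show ?thesis using v
        unfolding c by (simp add: field_simps power2_eq_square)
    qed
    moreover have "sqrt (2 * pi * (1 / sqrt v)\<^sup>2) = sqrt (2 * pi) / sqrt v"
      using v by (simp add: power_divide real_sqrt_divide)
    ultimately show ?thesis using v
      by (simp add: normal_density_def field_simps flip: exp_add)
  qed
  have "(\<integral>\<^sup>+z. ennreal (std_normal_density z) * ennreal (exp (b * z + c * z\<^sup>2)) \<partial>lborel)
      = (\<integral>\<^sup>+z. ennreal (exp (b\<^sup>2 / (2 * v)) / sqrt v) * ennreal (normal_density (b / v) (1 / sqrt v) z) \<partial>lborel)"
    using v by (intro nn_integral_cong) (simp add: eq ennreal_mult'' flip: ennreal_mult')
  also have "\<dots> = ennreal (exp (b\<^sup>2 / (2 * v)) / sqrt v) * (\<integral>\<^sup>+z. ennreal (normal_density (b / v) (1 / sqrt v) z) \<partial>lborel)"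
    by (intro nn_integral_cmult) auto
  also have "(\<integral>\<^sup>+z. ennreal (normal_density (b / v) (1 / sqrt v) z) \<partial>lborel) = 1"
    using v by (subst nn_integral_eq_integral) auto
  finally show ?thesis by (simp add: v_def)
qed

text \<open>Noise at unit variance: in the final theorem \<open>Z\<close> is the error divided by
  \<sigma>.\<close>

locale std_gaussian = prob_space M for M :: "'a measure" +
  fixes n :: nat and Z :: "nat \<Rightarrow> 'a \<Rightarrow> real"
  assumes indep: "indep_vars (\<lambda>_. borel) Z {1..n}"
    and std: "\<And>i. i \<in> {1..n} \<Longrightarrow> distributed M lborel (Z i) std_normal_density"
begin

definition W :: "'a \<Rightarrow> real vec" where "W \<omega> = vec n (\<lambda>i. Z (Suc i) \<omega>)"

lemma W_carrier [simp]: "W \<omega> \<in> carrier_vec n"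
  by (simp add: W_def)

lemma Z_measurable [measurable]: "i < n \<Longrightarrow> Z (Suc i) \<in> borel_measurable M"
  using indep unfolding indep_vars_def by auto

lemma ip_W: "a \<bullet> W \<omega> = (\<Sum>i = 0..<n. a $ i * Z (Suc i) \<omega>)"
  by (simp add: scalar_prod_def W_def)

lemma ip_W_measurable [measurable]: "(\<lambda>\<omega>. a \<bullet> W \<omega>) \<in> borel_measurable M"
  unfolding ip_W by measurable

lemma W_W: "W \<omega> \<bullet> W \<omega> = (\<Sum>i = 0..<n. (Z (Suc i) \<omega>)\<^sup>2)"
  by (simp add: scalar_prod_def W_def power2_eq_square)

lemma W_W_measurable [measurable]: "(\<lambda>\<omega>. W \<omega> \<bullet> W \<omega>) \<in> borel_measurable M"
  unfolding W_W by measurable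

text \<open>Independence factors the expectation into one-dimensional Gaussian integrals. Setting
  \<open>c = 0\<close> yields linear forms in the noise, \<open>b = 0\<close> its squared
  norm.\<close>

lemma nn_integral_prod_exp:
  assumes c: "2 * c < 1"
  shows "(\<integral>\<^sup>+\<omega>. ennreal (exp (\<Sum>i = 0..<n. b i * Z (Suc i) \<omega> + c * (Z (Suc i) \<omega>)\<^sup>2)) \<partial>M)
    = ennreal (\<Prod>i = 0..<n. exp ((b i)\<^sup>2 / (2 * (1 - 2 * c))) / sqrt (1 - 2 * c))"
proof -
  \<comment> \<open>\<open>Z\<close> is numbered from 1 and vector entries from 0, hence the index
    \<open>i - 1\<close>.\<close>
  let ?f = "\<lambda>i z. ennreal (exp (b (i - 1) * z + c * z\<^sup>2))"
  have shift: "(\<Prod>i = 1..n. g i) = (\<Prod>i = 0..<n. g (Suc i))" for g :: "nat \<Rightarrow> ennreal"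
    by (rule prod.reindex_bij_witness[where i = Suc and j = "\<lambda>i. i - 1"]) auto
  have "indep_vars (\<lambda>_. borel) (\<lambda>i \<omega>. ?f i (Z i \<omega>)) {1..n}"
    by (rule indep_vars_compose2[OF indep]) auto
  then have "(\<integral>\<^sup>+\<omega>. (\<Prod>i = 1..n. ?f i (Z i \<omega>)) \<partial>M) = (\<Prod>i = 1..n. \<integral>\<^sup>+\<omega>. ?f i (Z i \<omega>) \<partial>M)"
    by (intro indep_vars_nn_integral) auto
  also have "\<dots> = (\<Prod>i = 1..n. ennreal (exp ((b (i - 1))\<^sup>2 / (2 * (1 - 2 * c))) / sqrt (1 - 2 * c)))"
  proof (intro prod.cong refl)
    fix i assume i: "i \<in> {1..n}"
    have "(\<integral>\<^sup>+\<omega>. ?f i (Z i \<omega>) \<partial>M) = (\<integral>\<^sup>+z. ennreal (std_normal_density z) * ?f i z \<partial>lborel)"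
      by (rule distributed_nn_integral[OF std[OF i], symmetric]) auto
    then show "(\<integral>\<^sup>+\<omega>. ?f i (Z i \<omega>) \<partial>M)
        = ennreal (exp ((b (i - 1))\<^sup>2 / (2 * (1 - 2 * c))) / sqrt (1 - 2 * c))"
      using nn_integral_std_normal_exp_quadratic[OF c] by simp
  qed
  finally show ?thesis using c
    unfolding shift exp_sum[OF finite_atLeastLessThan]
    by (simp only: prod_ennreal diff_Suc_1 exp_ge_zero divide_nonneg_nonneg real_sqrt_ge_zero diff_ge_0_iff_ge less_imp_le)
qed

lemma nn_integral_exp_ip_W:
  assumes "a \<in> carrier_vec n"
  shows "(\<integral>\<^sup>+\<omega>. ennreal (exp (a \<bullet> W \<omega>)) \<partial>M) = ennreal (exp (a \<bullet> a / 2))"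
proof -
  have "a \<bullet> a / 2 = (\<Sum>i = 0..<n. (a $ i)\<^sup>2 / 2)"
    using assms by (simp add: scalar_prod_def power2_eq_square sum_divide_distrib)
  then show ?thesis
    using nn_integral_prod_exp[of 0 "\<lambda>i. a $ i"] by (simp add: ip_W flip: exp_sum)
qed

lemma nn_integral_exp_W_W:
  assumes "2 * c < 1"
  shows "(\<integral>\<^sup>+\<omega>. ennreal (exp (c * (W \<omega> \<bullet> W \<omega>))) \<partial>M) = ennreal ((1 / sqrt (1 - 2 * c)) ^ n)"
  using nn_integral_prod_exp[of c "\<lambda>_. 0"] assms
  by (simp add: W_W sum_distrib_left)

text \<open>
  The identity \<open>exp (l z\<^sup>2) = E exp (sqrt (2 l) g z)\<close> with \<open>g\<close> standard normal turns one squared term of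
  the exponent into a linear one; this avoids rotation invariance, and it is why the linear term
  \<open>a\<close> is carried through the induction.
\<close>

lemma nn_integral_exp_orthonormal:
  assumes l: "0 \<le> l" "2 * l < 1" and "orthonormal_list n us" and "a \<in> carrier_vec n"
  shows "(\<integral>\<^sup>+\<omega>. ennreal (exp (l * (\<Sum>u\<leftarrow>us. (u \<bullet> W \<omega>)\<^sup>2) + a \<bullet> W \<omega>)) \<partial>M)
    = ennreal ((1 / sqrt (1 - 2 * l)) ^ length us
        * exp (a \<bullet> a / 2 + l / (1 - 2 * l) * (\<Sum>u\<leftarrow>us. (u \<bullet> a)\<^sup>2)))"
  using assms(3,4)
proof (induction us arbitrary: a)
  case Nil
  then show ?case by (simp add: nn_integral_exp_ip_W)
next
  case (Cons u us)
  define s where "s = sqrt (2 * l)"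
  have s2: "s\<^sup>2 = 2 * l" using l by (simp add: s_def)
  define q where "q = l / (1 - 2 * l)"
  define c where "c = 1 / sqrt (1 - 2 * l)"
  have c0: "c \<ge> 0" using l by (simp add: c_def)
  let ?S = "\<lambda>v. \<Sum>u\<leftarrow>us. (u \<bullet> v)\<^sup>2"
  have u: "u \<in> carrier_vec n" "u \<bullet> u = 1" "\<And>v. v \<in> set us \<Longrightarrow> u \<bullet> v = 0"
    and us: "orthonormal_list n us" and usC: "set us \<subseteq> carrier_vec n" and a: "a \<in> carrier_vec n"
    using Cons.prems by (auto simp: orthonormal_list_Cons) (auto simp: orthonormal_list_def)
  have Sm [measurable]: "(\<lambda>\<omega>. ?S (W \<omega>)) \<in> borel_measurable M"
    by (induction us) simp_all
  \<comment> \<open>The linear term after the square of \<open>u \<bullet> W \<omega>\<close> has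
    been linearised by the auxiliary Gaussian value \<open>g\<close>.\<close>
  define d where "d g = a + (s * g) \<cdot>\<^sub>v u" for g
  have dC: "d g \<in> carrier_vec n" for g using a u by (simp add: d_def)
  have d_ip: "d g \<bullet> y = a \<bullet> y + s * g * (u \<bullet> y)" if "y \<in> carrier_vec n" for y g
    unfolding d_def using add_scalar_prod_distrib[OF a _ that, of "(s * g) \<cdot>\<^sub>v u"] u that by simp
  have dd: "d g \<bullet> d g = a \<bullet> a + 2 * s * g * (u \<bullet> a) + 2 * l * g\<^sup>2" for g
  proof -
    have "a \<bullet> d g = a \<bullet> a + s * g * (u \<bullet> a)" "u \<bullet> d g = u \<bullet> a + s * g"
      using d_ip[OF a, of g] d_ip[OF u(1), of g] u(2) comm_scalar_prod[OF dC[of g] a]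
        comm_scalar_prod[OF dC[of g] u(1)] comm_scalar_prod[OF a u(1)] by simp_all
    then have "d g \<bullet> d g = a \<bullet> a + 2 * s * g * (u \<bullet> a) + s\<^sup>2 * g\<^sup>2"
      using d_ip[OF dC, of g g] by (simp add: algebra_simps power2_eq_square)
    then show ?thesis using s2 by simp
  qed
  \<comment> \<open>The shift is along \<open>u\<close>, which is orthogonal to all remaining
    vectors.\<close>
  have Sd: "?S (d g) = ?S a" for g
  proof -
    have "v \<bullet> d g = v \<bullet> a" if "v \<in> set us" for v
    proof -
      have v: "v \<in> carrier_vec n" using that usC by auto
      show ?thesis using d_ip[OF v, of g] u(3)[OF that] comm_scalar_prod[OF v dC[of g]] comm_scalar_prod[OF v a] by simp
    qed
    then show ?thesis by (intro arg_cong[where f = sum_list] map_cong) auto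
  qed
  interpret pair_sigma_finite M lborel
    by (intro pair_sigma_finite.intro sigma_finite_measure_axioms lborel.sigma_finite_measure_axioms)
  have "(\<integral>\<^sup>+\<omega>. ennreal (exp (l * (\<Sum>u\<leftarrow>u # us. (u \<bullet> W \<omega>)\<^sup>2) + a \<bullet> W \<omega>)) \<partial>M)
     = (\<integral>\<^sup>+\<omega>. \<integral>\<^sup>+g. ennreal (std_normal_density g) * ennreal (exp (l * ?S (W \<omega>) + d g \<bullet> W \<omega>)) \<partial>lborel \<partial>M)"
  proof (rule nn_integral_cong)
    fix \<omega>
    let ?z = "u \<bullet> W \<omega>"
    have "(\<integral>\<^sup>+g. ennreal (std_normal_density g) * ennreal (exp (l * ?S (W \<omega>) + d g \<bullet> W \<omega>)) \<partial>lborel)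
      = (\<integral>\<^sup>+g. ennreal (exp (l * ?S (W \<omega>) + a \<bullet> W \<omega>)) *
           (ennreal (std_normal_density g) * ennreal (exp (s * ?z * g + 0 * g\<^sup>2))) \<partial>lborel)"
      by (intro nn_integral_cong) (simp add: d_ip exp_add ac_simps flip: ennreal_mult'')
    also have "\<dots> = ennreal (exp (l * ?S (W \<omega>) + a \<bullet> W \<omega>)) * ennreal (exp (l * ?z\<^sup>2))"
      using nn_integral_std_normal_exp_quadratic[of 0 "s * ?z"]
      by (subst nn_integral_cmult) (auto simp: power_mult_distrib s2)
    also have "\<dots> = ennreal (exp (l * (\<Sum>u\<leftarrow>u # us. (u \<bullet> W \<omega>)\<^sup>2) + a \<bullet> W \<omega>))"
      by (simp add: algebra_simps flip: ennreal_mult'' exp_add)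
    finally show "ennreal (exp (l * (\<Sum>u\<leftarrow>u # us. (u \<bullet> W \<omega>)\<^sup>2) + a \<bullet> W \<omega>)) =
      (\<integral>\<^sup>+g. ennreal (std_normal_density g) * ennreal (exp (l * ?S (W \<omega>) + d g \<bullet> W \<omega>)) \<partial>lborel)" ..
  qed
  \<comment> \<open>Exchanging the integrals averages over the noise at fixed \<open>g\<close>,
    where the induction hypothesis applies with linear term \<open>d g\<close>.\<close>
  also have "\<dots> = (\<integral>\<^sup>+g. \<integral>\<^sup>+\<omega>. ennreal (std_normal_density g) * ennreal (exp (l * ?S (W \<omega>) + d g \<bullet> W \<omega>)) \<partial>M \<partial>lborel)"
    unfolding d_ip[OF W_carrier] by (rule Fubini'[symmetric]) measurable
  also have "\<dots> = (\<integral>\<^sup>+g. ennreal (std_normal_density g) *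
      ennreal (c ^ length us * exp (d g \<bullet> d g / 2 + q * ?S (d g))) \<partial>lborel)"
    unfolding c_def q_def using Cons.IH[OF us dC]
    by (subst nn_integral_cmult) simp_all
  \<comment> \<open>The exponent is quadratic in \<open>g\<close>, with coefficient \<open>l\<close>
    by the choice of \<open>s\<close>; a second Gaussian integral supplies the factor belonging to
    \<open>u\<close>.\<close>
  also have "\<dots> = (\<integral>\<^sup>+g. ennreal (c ^ length us * exp (a \<bullet> a / 2 + q * ?S a)) *
       (ennreal (std_normal_density g) * ennreal (exp (s * (u \<bullet> a) * g + l * g\<^sup>2))) \<partial>lborel)"
    unfolding dd Sd using c0
    by (intro nn_integral_cong) (simp add: exp_add ac_simps add_divide_distrib flip: ennreal_mult'' )
  also have "\<dots> = ennreal (c ^ length us * exp (a \<bullet> a / 2 + q * ?S a)) *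
       ennreal (exp ((s * (u \<bullet> a))\<^sup>2 / (2 * (1 - 2 * l))) / sqrt (1 - 2 * l))"
    using nn_integral_std_normal_exp_quadratic[OF l(2), of "s * (u \<bullet> a)"]
    by (subst nn_integral_cmult) auto
  also have "(s * (u \<bullet> a))\<^sup>2 / (2 * (1 - 2 * l)) = q * (u \<bullet> a)\<^sup>2"
    using l by (simp add: power_mult_distrib s2 q_def divide_simps)
  also have "ennreal (c ^ length us * exp (a \<bullet> a / 2 + q * ?S a)) * ennreal (exp (q * (u \<bullet> a)\<^sup>2) / sqrt (1 - 2 * l))
    = ennreal (c ^ length (u # us) * exp (a \<bullet> a / 2 + q * (\<Sum>u\<leftarrow>u # us. (u \<bullet> a)\<^sup>2)))"
    using l c0 by (simp add: c_def algebra_simps exp_add flip: ennreal_mult'')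
  finally show ?case unfolding c_def q_def .
qed

section \<open>Chernoff tail bounds\<close>

lemma sum_list_sq_measurable [measurable]: "(\<lambda>\<omega>. \<Sum>u\<leftarrow>us. (u \<bullet> W \<omega>)\<^sup>2) \<in> borel_measurable M"
  by (induction us) simp_all

lemma prob_ge_le_exp:
  assumes [measurable]: "f \<in> borel_measurable M" and l: "l > 0" and B: "B \<ge> 0"
    and le: "(\<integral>\<^sup>+\<omega>. ennreal (exp (l * f \<omega>)) \<partial>M) \<le> ennreal B"
  shows "prob {\<omega> \<in> space M. f \<omega> \<ge> t} \<le> exp (- (l * t)) * B"
proof -
  have "emeasure M {\<omega> \<in> space M. f \<omega> \<ge> t}
      \<le> ennreal (exp (- l * t)) * (\<integral>\<^sup>+\<omega>. ennreal (exp (l * f \<omega>)) * indicator (space M) \<omega> \<partial>M)"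
    by (rule Chernoff_ineq_nn_integral_ge[OF l]) auto
  also have "(\<integral>\<^sup>+\<omega>. ennreal (exp (l * f \<omega>)) * indicator (space M) \<omega> \<partial>M)
      = (\<integral>\<^sup>+\<omega>. ennreal (exp (l * f \<omega>)) \<partial>M)"
    by (intro nn_integral_cong) simp
  also have "ennreal (exp (- l * t)) * \<dots> \<le> ennreal (exp (- l * t)) * ennreal B"
    by (intro mult_left_mono le) simp
  also have "\<dots> = ennreal (exp (- (l * t)) * B)"
    using B by (simp add: ennreal_mult)
  finally show ?thesis using B by (simp add: emeasure_eq_measure)
qed

text \<open>Chernoff bound with zero linear term. Each direction contributes a factor of at least 1,
  so the number of directions may be overestimated by \<open>d\<close>.\<close>

lemma prob_orthonormal_ge:
  assumes "0 < l" "2 * l < 1" "orthonormal_list n us" "length us \<le> d"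
  shows "prob {\<omega> \<in> space M. (\<Sum>u\<leftarrow>us. (u \<bullet> W \<omega>)\<^sup>2) \<ge> t}
    \<le> exp (- (l * t)) * (1 / sqrt (1 - 2 * l)) ^ d"
proof (rule prob_ge_le_exp)
  have z: "0\<^sub>v n \<in> carrier_vec n" by simp
  have us: "set us \<subseteq> carrier_vec n" using assms(3) by (simp add: orthonormal_list_def)
  have "(\<Sum>u\<leftarrow>us. (u \<bullet> 0\<^sub>v n)\<^sup>2) = 0"
    using us by (induction us) (auto simp: scalar_prod_right_zero)
  moreover have "0\<^sub>v n \<bullet> W \<omega> = 0" for \<omega> using scalar_prod_left_zero[OF W_carrier] .
  ultimately have "(\<integral>\<^sup>+\<omega>. ennreal (exp (l * (\<Sum>u\<leftarrow>us. (u \<bullet> W \<omega>)\<^sup>2))) \<partial>M)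
      = ennreal ((1 / sqrt (1 - 2 * l)) ^ length us)"
    using nn_integral_exp_orthonormal[of l us "0\<^sub>v n"] assms z
    by (simp add: scalar_prod_left_zero[OF z])
  also have "\<dots> \<le> ennreal ((1 / sqrt (1 - 2 * l)) ^ d)"
    using assms by (intro ennreal_leI power_increasing) auto
  finally show "(\<integral>\<^sup>+\<omega>. ennreal (exp (l * (\<Sum>u\<leftarrow>us. (u \<bullet> W \<omega>)\<^sup>2))) \<partial>M)
      \<le> ennreal ((1 / sqrt (1 - 2 * l)) ^ d)" .
qed (use assms in auto)

lemma prob_ip_W_ge:
  assumes "a \<in> carrier_vec n"
  shows "prob {\<omega> \<in> space M. a \<bullet> W \<omega> \<ge> t} \<le> exp (- t) * exp (a \<bullet> a / 2)"
  using prob_ge_le_exp[of "\<lambda>\<omega>. a \<bullet> W \<omega>" 1 "exp (a \<bullet> a / 2)" t] nn_integral_exp_ip_W[OF assms]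
  by simp

lemma prob_W_W_ge:
  assumes "0 < l" "2 * l < 1"
  shows "prob {\<omega> \<in> space M. W \<omega> \<bullet> W \<omega> \<ge> t} \<le> exp (- (l * t)) * (1 / sqrt (1 - 2 * l)) ^ n"
  by (rule prob_ge_le_exp) (use assms nn_integral_exp_W_W in auto)

lemma prob_W_W_le:
  assumes "0 < l"
  shows "prob {\<omega> \<in> space M. W \<omega> \<bullet> W \<omega> \<le> t} \<le> exp (l * t) * (1 / sqrt (1 + 2 * l)) ^ n"
  using prob_ge_le_exp[of "\<lambda>\<omega>. - (W \<omega> \<bullet> W \<omega>)" l "(1 / sqrt (1 + 2 * l)) ^ n" "-t"]
    nn_integral_exp_W_W[of "-l"] assms by simp

end

section \<open>Union bounds over models\<close>

text \<open>Expanding a product over the predictors, the sum equals (1 + 1/p)^p. It is the total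
  weight available for union bounds over all models.\<close>

lemma sum_Pow_power_card_le:
  assumes "p \<ge> 1"
  shows "(\<Sum>s\<in>Pow {1..p::nat}. (1 / real p) ^ card s) \<le> exp 1"
proof -
  have "(\<Sum>s\<in>Pow {1..p}. (1 / real p) ^ card s) = (1 / real p + 1) ^ p"
    using prod_add[of "{1..p}" "\<lambda>_. 1 / real p" "\<lambda>_. 1"] by simp
  also have "\<dots> \<le> exp (1 / real p) ^ p"
    using exp_ge_add_one_self[of "1 / real p"] by (intro power_mono) (auto simp: add.commute)
  also have "\<dots> = exp 1" using assms by (simp flip: exp_of_nat_mult)
  finally show ?thesis .
qed

lemma finite_models_upto: "finite (models_upto p K)"
  by (rule finite_subset[of _ "Pow {1..p}"]) (auto simp: models_upto_def)

text \<open>Weighted union bound: \<open>b\<close> is the common rate and \<open>w s\<close> the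
  share of model \<open>s\<close>, so the number of models does not enter.\<close>

lemma (in prob_space) prob_Bex_le:
  assumes I: "finite I" and A: "\<And>s. s \<in> I \<Longrightarrow> {\<omega> \<in> space M. P s \<omega>} \<in> sets M"
    and le: "\<And>s. s \<in> I \<Longrightarrow> prob {\<omega> \<in> space M. P s \<omega>} \<le> b * w s"
    and w: "sum w I \<le> c" and b: "b \<ge> 0"
  shows "prob {\<omega> \<in> space M. \<exists>s\<in>I. P s \<omega>} \<le> b * c"
proof -
  have "prob {\<omega> \<in> space M. \<exists>s\<in>I. P s \<omega>} = prob (\<Union>s\<in>I. {\<omega> \<in> space M. P s \<omega>})"
    by (intro arg_cong[where f = prob]) auto
  also have "\<dots> \<le> (\<Sum>s\<in>I. prob {\<omega> \<in> space M. P s \<omega>})"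
    using I A by (intro measure_UNION_le) auto
  also have "\<dots> \<le> (\<Sum>s\<in>I. b * w s)" using le by (rule sum_mono)
  also have "\<dots> = b * sum w I" by (simp add: sum_distrib_left)
  also have "\<dots> \<le> b * c" using w b by (rule mult_left_mono)
  finally show ?thesis .
qed

lemma sum_models_le:
  assumes "p \<ge> 1"
  shows "(\<Sum>s\<in>models_upto p K. (1 / real p) ^ card s) \<le> exp 1"
proof -
  have "(\<Sum>s\<in>models_upto p K. (1 / real p) ^ card s) \<le> (\<Sum>s\<in>Pow {1..p}. (1 / real p) ^ card s)"
    by (intro sum_mono2) (auto simp: models_upto_def)
  then show ?thesis using sum_Pow_power_card_le[OF assms] by simp
qed

text \<open>Removing \<open>s0\<close> is injective on its supersets, which reduces the sum to one
  over arbitrary sets of extra predictors.\<close>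

lemma sum_supermodels_le:
  assumes "p \<ge> 1"
  shows "(\<Sum>s\<in>{s \<in> models_upto p K. s0 \<subset> s}. (1 / real p) ^ card (s - s0)) \<le> exp 1"
proof -
  let ?I = "{s \<in> models_upto p K. s0 \<subset> s}"
  have "inj_on (\<lambda>s. s - s0) ?I" by (auto simp: inj_on_def)
  then have "(\<Sum>s\<in>?I. (1 / real p) ^ card (s - s0)) = (\<Sum>t\<in>(\<lambda>s. s - s0) ` ?I. (1 / real p) ^ card t)"
    by (simp add: sum.reindex)
  also have "\<dots> \<le> (\<Sum>s\<in>Pow {1..p}. (1 / real p) ^ card s)"
    by (intro sum_mono2) (auto simp: models_upto_def)
  finally show ?thesis using sum_Pow_power_card_le[OF assms] by simp
qed

text \<open>Splits a tail exponent: the part \<open>K\<close> pays for the weight of a model of size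
  at most \<open>K\<close>, the part \<open>q\<close> remains as rate.\<close>

lemma exp_card_bound:
  assumes "p \<ge> 1" "real c \<le> K"
  shows "exp (- ((K + q) * ln (real p))) \<le> exp (- (q * ln (real p))) * (1 / real p) ^ c"
proof -
  have "(1 / real p) ^ c = exp (- (real c * ln (real p)))"
    using assms by (simp add: exp_minus exp_of_nat_mult power_one_over inverse_eq_divide)
  moreover have "real c * ln (real p) \<le> K * ln (real p)"
    using assms by (intro mult_right_mono) auto
  ultimately show ?thesis by (simp add: algebra_simps flip: exp_add)
qed

section \<open>Tail bounds uniform over models\<close>

context std_gaussian
begin

lemma hat_quad_W_measurable [measurable]:
  assumes "finite s"
  shows "(\<lambda>\<omega>. hat_quad n x s (W \<omega>)) \<in> borel_measurable M"
proof -
  obtain us where "\<forall>v\<in>carrier_vec n. hat_quad n x s v = (\<Sum>u\<leftarrow>us. (u \<bullet> v)\<^sup>2)"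
    using hat_quad_eq_sum[OF assms] by blast
  then show ?thesis by simp
qed

text \<open>Chernoff with parameter 1/4 leaves the exponent (2K + q) ln p. One K absorbs the
  normalising factor, the square root of 2 to the power \<open>card s + 1\<close>, since (c + 1)/2
  is at most K for c at most K and K at least 1; the other K pays for the union bound.\<close>

lemma prob_hat_quad_uniform:
  assumes p: "p \<ge> 1" and L: "ln (real p) \<ge> 1" and K: "K \<ge> 1"
  shows "prob {\<omega> \<in> space M. \<exists>s\<in>models_upto p K.
      hat_quad n x s (W \<omega>) \<ge> 4 * (2 * K + q) * ln (real p)} \<le> exp (- (q * ln (real p))) * exp 1"
proof (rule prob_Bex_le[OF finite_models_upto])
  fix s assume s: "s \<in> models_upto p K"
  then have fin: "finite s" and c: "real (card s) \<le> K"
    using finite_subset by (auto simp: models_upto_def)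
  let ?t = "4 * (2 * K + q) * ln (real p)"
  note [measurable] = hat_quad_W_measurable[OF fin]
  show "{\<omega> \<in> space M. ?t \<le> hat_quad n x s (W \<omega>)} \<in> sets M" by measurable
  obtain us where us: "orthonormal_list n us" "length us \<le> card s + 1"
    "\<forall>v\<in>carrier_vec n. hat_quad n x s v = (\<Sum>u\<leftarrow>us. (u \<bullet> v)\<^sup>2)"
    using hat_quad_eq_sum[OF fin] by blast
  have "prob {\<omega> \<in> space M. ?t \<le> hat_quad n x s (W \<omega>)}
      = prob {\<omega> \<in> space M. ?t \<le> (\<Sum>u\<leftarrow>us. (u \<bullet> W \<omega>)\<^sup>2)}"
    using us(3) by simp
  also have "\<dots> \<le> exp (- (1/4 * ?t)) * (1 / sqrt (1 - 2 * (1/4))) ^ (card s + 1)"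
    by (rule prob_orthonormal_ge) (use us in auto)
  also have "(1 / sqrt (1 - 2 * (1/4))) ^ (card s + 1) \<le> exp (K * ln (real p))"
  proof -
    have "(2::real) \<le> exp 1" using exp_ge_add_one_self[of 1] by simp
    then have "sqrt 2 \<le> sqrt (exp 1)" by simp
    also have "sqrt (exp 1) = exp (1/2)"
      by (rule real_sqrt_unique) (simp_all add: power2_eq_square flip: exp_add)
    finally have "(1 / sqrt (1 - 2 * (1/4))) ^ (card s + 1) \<le> exp (1/2) ^ (card s + 1)"
      by (intro power_mono) (auto simp: real_sqrt_divide)
    also have "\<dots> = exp (real (card s + 1) * (1/2))"
      by (rule exp_of_nat_mult[symmetric])
    also have "real (card s + 1) * (1/2) \<le> K * 1" using c K by simp
    also have "K * 1 \<le> K * ln (real p)" using K L by (intro mult_left_mono) auto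
    finally show ?thesis by simp
  qed
  also have "exp (- (1/4 * ?t)) * exp (K * ln (real p)) = exp (- ((K + q) * ln (real p)))"
    by (simp add: algebra_simps flip: exp_add)
  also have "\<dots> \<le> exp (- (q * ln (real p))) * (1 / real p) ^ card s"
    by (rule exp_card_bound[OF p c])
  finally show "prob {\<omega> \<in> space M. ?t \<le> hat_quad n x s (W \<omega>)}
      \<le> exp (- (q * ln (real p))) * (1 / real p) ^ card s" by simp
qed (use sum_models_le[OF p] in auto)

text \<open>Gaussian tail bound for \<open>- l\<close> times \<open>r s\<close>: half its squared
  norm cancels exactly against the first term of the threshold, leaving the exponent (K + q) ln p.
  The parameter \<open>l\<close> trades bias against the logarithmic term.\<close>

lemma prob_gap_uniform:
  assumes p: "p \<ge> 1" and l: "l > 0" and r: "\<And>s. r s \<in> carrier_vec n"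
  shows "prob {\<omega> \<in> space M. \<exists>s\<in>models_upto p K.
      - (r s \<bullet> W \<omega>) \<ge> l * (r s \<bullet> r s) / 2 + (K + q) * ln (real p) / l} \<le> exp (- (q * ln (real p))) * exp 1"
proof (rule prob_Bex_le[OF finite_models_upto])
  fix s assume s: "s \<in> models_upto p K"
  then have c: "real (card s) \<le> K" by (auto simp: models_upto_def)
  let ?t = "l * (r s \<bullet> r s) / 2 + (K + q) * ln (real p) / l"
  show "{\<omega> \<in> space M. ?t \<le> - (r s \<bullet> W \<omega>)} \<in> sets M" by measurable
  let ?a = "(- l) \<cdot>\<^sub>v r s"
  have a: "?a \<in> carrier_vec n" using r by simp
  have aW: "?a \<bullet> W \<omega> = - l * (r s \<bullet> W \<omega>)" for \<omega>
    by (rule smult_scalar_prod_distrib[OF r W_carrier])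
  have aa: "?a \<bullet> ?a = l\<^sup>2 * (r s \<bullet> r s)"
    using smult_scalar_prod_distrib[OF r a, of "- l"] scalar_prod_smult_distrib[OF r r, of s "- l"]
    by (simp add: power2_eq_square)
  have "prob {\<omega> \<in> space M. ?t \<le> - (r s \<bullet> W \<omega>)} = prob {\<omega> \<in> space M. l * ?t \<le> ?a \<bullet> W \<omega>}"
  proof -
    have "?t \<le> - (r s \<bullet> W \<omega>) \<longleftrightarrow> l * ?t \<le> ?a \<bullet> W \<omega>" for \<omega>
      using mult_le_cancel_left_pos[OF l, of ?t "- (r s \<bullet> W \<omega>)"] unfolding aW by simp
    then show ?thesis by simp
  qed
  also have "\<dots> \<le> exp (- (l * ?t)) * exp (?a \<bullet> ?a / 2)"
    by (rule prob_ip_W_ge[OF a])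
  also have "\<dots> = exp (- ((K + q) * ln (real p)))"
    using l unfolding aa by (simp add: field_simps power2_eq_square flip: exp_add)
  also have "\<dots> \<le> exp (- (q * ln (real p))) * (1 / real p) ^ card s"
    by (rule exp_card_bound[OF p c])
  finally show "prob {\<omega> \<in> space M. ?t \<le> - (r s \<bullet> W \<omega>)}
      \<le> exp (- (q * ln (real p))) * (1 / real p) ^ card s" .
qed (use sum_models_le[OF p] in auto)

text \<open>With m extra predictors the Chernoff bound is the m-th power of the left side of
  \<open>tb\<close>, so each extra predictor costs \<open>b / p\<close>. The powers of 1/p pay for
  the union bound; since m is at least 1, one factor \<open>b\<close> survives as rate.\<close>

lemma prob_hat_quad_increment_uniform:
  assumes p: "p \<ge> 1" and t: "t > 1" and b: "0 \<le> b" "b \<le> 1"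
    and tb: "sqrt t * exp ((1 - t) / 2) \<le> b / real p"
  shows "prob {\<omega> \<in> space M. \<exists>s\<in>{s \<in> models_upto p K. s0 \<subset> s}.
      hat_quad n x s (W \<omega>) - hat_quad n x s0 (W \<omega>) \<ge> t * real (card (s - s0))} \<le> b * exp 1"
proof (rule prob_Bex_le)
  show "finite {s \<in> models_upto p K. s0 \<subset> s}" using finite_models_upto by simp
  fix s assume s: "s \<in> {s \<in> models_upto p K. s0 \<subset> s}"
  then have fin: "finite s" and sub: "s0 \<subset> s" using finite_subset by (auto simp: models_upto_def)
  then have fin0: "finite s0" using finite_subset by blast
  note [measurable] = hat_quad_W_measurable[OF fin] hat_quad_W_measurable[OF fin0]
  let ?m = "card (s - s0)"
  let ?E = "\<lambda>\<omega>. t * real ?m \<le> hat_quad n x s (W \<omega>) - hat_quad n x s0 (W \<omega>)"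
  show "{\<omega> \<in> space M. ?E \<omega>} \<in> sets M" by measurable
  have m: "?m \<ge> 1" using fin sub by (simp add: Suc_le_eq card_gt_0_iff)
  obtain us where us: "orthonormal_list n us" "length us \<le> ?m"
    "\<forall>v\<in>carrier_vec n. hat_quad n x s v = hat_quad n x s0 v + (\<Sum>u\<leftarrow>us. (u \<bullet> v)\<^sup>2)"
    using hat_quad_extend[of s0 s n x] fin sub by blast
  \<comment> \<open>The minimiser of the Chernoff bound for a chi-squared variable at
    \<open>t\<close> times its degrees of freedom.\<close>
  define l where "l = 1/2 - 1 / (2 * t)"
  have l: "0 < l" "2 * l < 1" "1 - 2 * l = 1 / t" "l * t = (t - 1) / 2"
    using t by (auto simp: l_def field_simps)
  have "prob {\<omega> \<in> space M. ?E \<omega>} = prob {\<omega> \<in> space M. t * real ?m \<le> (\<Sum>u\<leftarrow>us. (u \<bullet> W \<omega>)\<^sup>2)}"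
    using us(3) by simp
  also have "\<dots> \<le> exp (- (l * (t * real ?m))) * (1 / sqrt (1 - 2 * l)) ^ ?m"
    by (rule prob_orthonormal_ge[OF l(1,2) us(1,2)])
  also have "- (l * (t * real ?m)) = real ?m * ((1 - t) / 2)"
  proof -
    have "l * (t * real ?m) = (t - 1) / 2 * real ?m" using l(4) by (simp flip: mult.assoc)
    then show ?thesis by (simp add: field_simps)
  qed
  also have "exp (real ?m * ((1 - t) / 2)) * (1 / sqrt (1 - 2 * l)) ^ ?m
      = (sqrt t * exp ((1 - t) / 2)) ^ ?m"
    unfolding l(3) exp_of_nat_mult using t by (simp add: real_sqrt_divide power_mult_distrib)
  also have "\<dots> \<le> (b / real p) ^ ?m"
    using tb t by (intro power_mono) auto
  also have "\<dots> = b ^ ?m * (1 / real p) ^ ?m" by (simp add: power_divide)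
  also have "\<dots> \<le> b * (1 / real p) ^ ?m"
    using b m power_decreasing[of 1 ?m b] by (intro mult_right_mono) auto
  finally show "prob {\<omega> \<in> space M. ?E \<omega>} \<le> b * (1 / real p) ^ ?m" .
qed (use sum_supermodels_le[OF p] b in auto)

end

section \<open>Comparison of the criterion on the good event\<close>

lemma hat_quad_nonneg:
  assumes "finite s" "v \<in> carrier_vec n"
  shows "hat_quad n x s v \<ge> 0"
  using hat_quad_eq_sum[OF assms(1), of n x] assms(2) by (auto intro!: sum_list_nonneg)

lemma ln_fact_le: 
  assumes "c \<le> p" "p \<ge> 1"
  shows "ln (fact c :: real) \<le> real c * ln (real p)"
proof -
  have "(fact c :: real) \<le> real c ^ c"
    using fact_le_power[of c, where 'a = real] by simp
  also have "\<dots> \<le> real p ^ c" using assms by (intro power_mono) auto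
  finally have "ln (fact c :: real) \<le> ln (real p ^ c)" by (intro ln_mono) auto
  then show ?thesis using assms by (simp add: ln_realpow)
qed

lemma fact_add_le: "fact (a + m) \<le> (fact a :: real) * real (a + m) ^ m"
proof (induction m)
  case (Suc m)
  have "fact (a + Suc m) = real (a + Suc m) * (fact (a + m) :: real)" by simp
  also have "\<dots> \<le> real (a + Suc m) * (fact a * real (a + m) ^ m)"
    using Suc by (intro mult_left_mono) auto
  also have "\<dots> \<le> real (a + Suc m) * (fact a * real (a + Suc m) ^ m)"
    by (intro mult_left_mono power_mono) auto
  finally show ?case by (simp add: ac_simps)
qed simp

text \<open>A relative increase \<open>x\<close> of the residual sum of squares gains at least
  B/(4S) times p0 ln p in the logarithmic term. The candidate can win back at most (3 + 2k) times p0
  ln p: the dropped penalty of the true model (ln n is at most ln p) and twice ln(c!).\<close>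

lemma criterion_gt_if_RSS_larger:
  fixes R R0 S B k :: real and n p p0 c :: nat
  assumes R0: "0 < R0" "R0 \<le> 2 * S * real n" and R: "R0 + B * (real p0 * ln (real p)) \<le> R"
    and S: "S > 0" and B: "B > 4 * S * (3 + 2 * k)" "B * (real p0 * ln (real p)) \<le> S * real n"
    and k: "k > 0" and c: "real c \<le> k * real p0" "c \<le> p" and p0: "p0 \<ge> 1" and n: "n \<ge> 1" "n \<le> p" "p \<ge> 2"
  shows "real n * ln R0 + real p0 * ln (real n) + 2 * real p0 * ln (real p) - 2 * ln (fact p0)
    < real n * ln R + real c * ln (real n) + 2 * real c * ln (real p) - 2 * ln (fact c)"
proof -
  define L where "L = ln (real p)"
  have L: "L > 0" using n by (simp add: L_def)
  define F where "F = ln (fact p0 :: real)"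
  \<comment> \<open>The absolute increase relative to the upper bound \<open>2 * S * real n\<close>
    for \<open>R0\<close>.\<close>
  define x where "x = B * (real p0 * L) / (2 * S * real n)"
  have Bpos: "B > 0" using B(1) S k by (smt (verit) mult_pos_pos)
  have x: "0 \<le> x" "x \<le> 1/2"
    using Bpos L S B(2) n by (auto simp: x_def L_def divide_simps mult.commute)
  have "R0 * (1 + x) \<le> R"
  proof -
    have "R0 * x \<le> 2 * S * real n * x" using R0 x by (intro mult_right_mono) auto
    also have "\<dots> = B * (real p0 * L)" using S n by (simp add: x_def)
    finally show ?thesis using R by (simp add: algebra_simps L_def)
  qed
  then have "ln (R0 * (1 + x)) \<le> ln R" using R0 x by (intro ln_mono) auto
  then have "ln R0 + ln (1 + x) \<le> ln R" using R0 x by (simp add: ln_mult)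
  \<comment> \<open>Follows from ln(1 + x) being at least x - x^2, with x at most 1/2.\<close>
  moreover have "x / 2 \<le> ln (1 + x)"
  proof -
    have "x\<^sup>2 \<le> x * (1/2)" using x unfolding power2_eq_square by (intro mult_left_mono) auto
    then show ?thesis using ln_one_plus_pos_lower_bound[of x] x by simp
  qed
  ultimately have "real n * (x / 2) \<le> real n * (ln R - ln R0)" by (intro mult_left_mono) auto
  moreover have "real n * (x / 2) = B / (4 * S) * (real p0 * L)" using n S by (simp add: x_def field_simps)
  moreover have "(3 + 2 * k) * (real p0 * L) < B / (4 * S) * (real p0 * L)"
    using B(1) S L p0 by (intro mult_strict_right_mono) (auto simp: field_simps)
  moreover have "ln (fact c) \<le> k * (real p0 * L)"
  proof -
    have "real c * L \<le> k * real p0 * L" using c L by (intro mult_right_mono) auto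
    moreover have "ln (fact c) \<le> real c * L" using ln_fact_le[of c p] c n by (simp add: L_def)
    ultimately show ?thesis unfolding mult.assoc by linarith
  qed
  moreover have "real p0 * ln (real n) \<le> real p0 * L"
    using n by (intro mult_left_mono) (auto simp: L_def)
  moreover have "0 \<le> real c * ln (real n)" "0 \<le> real c * L" "0 \<le> F"
    using n L by (auto simp: F_def)
  ultimately show ?thesis unfolding L_def[symmetric] F_def[symmetric] by (simp add: algebra_simps)
qed

text \<open>By ln y \<le> y - 1 the gain in fit is at most \<open>t * m / (1 - 2 * d)\<close>, while
  m extra predictors cost at least m times the bracket in \<open>t\<close>, because (p0 + m)! / p0!
  is at most K^m. The \<open>- 1\<close> in that hypothesis makes the comparison strict.\<close>

lemma criterion_gt_if_larger_model:
  fixes R R0 S K d t :: real and n p p0 m :: nat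
  assumes R0: "0 < R0" "R0 - R \<le> S * (t * real m)" and R: "S * (real n * (1 - 2 * d)) \<le> R"
    and S: "S > 0" and d: "0 \<le> d" "d < 1/2" and n: "n \<ge> 1" and m: "m \<ge> 1" and p0: "p0 \<ge> 1"
    and K: "real (p0 + m) \<le> K" and t0: "0 \<le> t"
    and t: "t \<le> (1 - 2 * d) * (ln (real n) + 2 * ln (real p) - 2 * ln K) - 1"
  shows "real n * ln R0 + real p0 * ln (real n) + 2 * real p0 * ln (real p) - 2 * ln (fact p0)
    < real n * ln R + real (p0 + m) * ln (real n) + 2 * real (p0 + m) * ln (real p) - 2 * ln (fact (p0 + m))"
proof -
  define D where "D = 1 - 2 * d"
  define \<Lambda> where "\<Lambda> = ln (real n) + 2 * ln (real p) - 2 * ln K"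
  have D: "D > 0" using d by (simp add: D_def)
  have SnD: "S * (real n * D) > 0" using S n D by simp
  have Rpos: "R > 0" using R SnD by (simp add: D_def)
  have "ln (R0 / R) \<le> R0 / R - 1" using R0 Rpos by (intro ln_le_minus_one) auto
  also have "\<dots> = (R0 - R) / R" using Rpos by (simp add: field_simps)
  also have "\<dots> \<le> S * (t * real m) / R" using R0 Rpos by (intro divide_right_mono) auto
  also have "\<dots> \<le> S * (t * real m) / (S * (real n * D))"
    using R SnD S t0 by (intro divide_left_mono) (auto simp: D_def intro: Rpos)
  also have "\<dots> = t * real m / (real n * D)" using S by simp
  finally have "real n * ln (R0 / R) \<le> real n * (t * real m / (real n * D))"
    by (intro mult_left_mono) auto
  also have "\<dots> = t / D * real m" using n by simp
  also have "\<dots> < \<Lambda> * real m"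
  proof -
    have "t < D * \<Lambda>" using t by (simp add: D_def \<Lambda>_def)
    then have "t / D < \<Lambda>" using D by (simp add: field_simps)
    then show ?thesis using m by (intro mult_strict_right_mono) auto
  qed
  finally have "real n * (ln R0 - ln R) < \<Lambda> * real m" using R0 Rpos by (simp add: ln_div)
  moreover have "ln (fact (p0 + m)) \<le> ln (fact p0) + real m * ln K"
  proof -
    have Kp: "K > 0" using K p0 by simp
    have "fact (p0 + m) \<le> (fact p0 :: real) * real (p0 + m) ^ m" by (rule fact_add_le)
    also have "\<dots> \<le> fact p0 * K ^ m" using K by (intro mult_left_mono power_mono) auto
    finally have "ln (fact (p0 + m)) \<le> ln (fact p0 * K ^ m)" by (intro ln_mono) auto
    then show ?thesis using Kp by (simp add: ln_mult ln_realpow)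
  qed
  ultimately show ?thesis by (simp add: \<Lambda>_def algebra_simps)
qed

lemma RSS_mean_plus_smult:
  assumes "w \<in> carrier_vec n"
  shows "RSS n x (mean_vec n p x \<beta> + \<sigma> \<cdot>\<^sub>v w) s = model_gap n p x \<beta> s
    + 2 * \<sigma> * (gap_vec n p x \<beta> s \<bullet> w) + \<sigma>\<^sup>2 * (w \<bullet> w - hat_quad n x s w)"
  using assms smult_carrier_vec[of \<sigma> w n]
  by (simp add: RSS_decomp hat_quad_smult scalar_prod_smult_distrib[OF gap_vec_carrier]
      power2_eq_square algebra_simps)

lemma mBIC2_minimal_at_true_model:
  fixes x :: "nat \<Rightarrow> nat \<Rightarrow> real" and \<beta> :: "nat \<Rightarrow> real" and p n :: nat and w :: "real vec"
    and \<sigma> k d t B C1 C3 :: real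
  defines "s0 \<equiv> true_model p \<beta>"
  defines "p0 \<equiv> card s0"
  defines "u \<equiv> real p0 * ln (real p)"
  defines "\<M> \<equiv> models_upto p (k * real p0)"
  assumes w: "w \<in> carrier_vec n" and \<sigma>: "\<sigma> > 0" and k: "k > 1"
    and n: "n \<ge> 1" "n \<le> p" "p \<ge> 2" and p0: "p0 \<ge> 1"
    and d: "0 \<le> d" "d \<le> 1/4" and C1: "C1 * u \<le> d * real n"
    and B: "B > 4 * \<sigma>\<^sup>2 * (3 + 2 * k)" "B * u \<le> \<sigma>\<^sup>2 * real n"
    and gap: "\<And>s. s \<in> \<M> \<Longrightarrow> \<not> s0 \<subseteq> s \<Longrightarrow> 2 * (B + 4 * \<sigma>\<^sup>2 * C3 + \<sigma>\<^sup>2 * C1) * u \<le> model_gap n p x \<beta> s"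
    and t0: "0 \<le> t"
    and t: "t \<le> (1 - 2 * d) * (ln (real n) + 2 * ln (real p) - 2 * ln (k * real p0)) - 1"
    and G1: "\<And>s. s \<in> \<M> \<Longrightarrow> hat_quad n x s w \<le> C1 * u"
    and G2: "real n * (1 - d) \<le> w \<bullet> w" "w \<bullet> w \<le> 2 * real n"
    and G3: "\<And>s. s \<in> \<M> \<Longrightarrow> - (gap_vec n p x \<beta> s \<bullet> w) \<le> model_gap n p x \<beta> s / (4 * \<sigma>) + 2 * \<sigma> * C3 * u"
    and G4: "\<And>s. s \<in> \<M> \<Longrightarrow> s0 \<subset> s \<Longrightarrow> hat_quad n x s w - hat_quad n x s0 w \<le> t * real (card (s - s0))"
    and s: "s \<in> \<M>" "s \<noteq> s0"
  shows "mBIC2 n p x (mean_vec n p x \<beta> + \<sigma> \<cdot>\<^sub>v w) s0 < mBIC2 n p x (mean_vec n p x \<beta> + \<sigma> \<cdot>\<^sub>v w) s"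
proof -
  let ?y = "mean_vec n p x \<beta> + \<sigma> \<cdot>\<^sub>v w"
  have fin0: "finite s0" by (simp add: s0_def true_model_def)
  have fin: "finite s" "s \<subseteq> {1..p}" "real (card s) \<le> k * real p0"
    using s finite_subset by (auto simp: \<M>_def models_upto_def)
  have cp: "card s \<le> p" using card_mono[OF _ fin(2)] by simp
  have s0M: "s0 \<in> \<M>"
    using k by (auto simp: \<M>_def models_upto_def s0_def p0_def true_model_def mult_le_cancel_right1)
  have RSS: "RSS n x ?y r = model_gap n p x \<beta> r + 2 * \<sigma> * (gap_vec n p x \<beta> r \<bullet> w) + \<sigma>\<^sup>2 * (w \<bullet> w - hat_quad n x r w)" for r
    by (rule RSS_mean_plus_smult[OF w])
  have RSS_super: "RSS n x ?y r = \<sigma>\<^sup>2 * (w \<bullet> w - hat_quad n x r w)" if "s0 \<subseteq> r" "finite r" for r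
    using gap_vec_eq_0[of p \<beta> r n x] that scalar_prod_left_zero[OF w]
    unfolding RSS model_gap_eq by (simp add: s0_def scalar_prod_left_zero[of "0\<^sub>v n" n])
  have S: "\<sigma>\<^sup>2 > 0" using \<sigma> by simp
  have q0: "hat_quad n x r w \<ge> 0" if "finite r" for r using hat_quad_nonneg[OF that w] .
  \<comment> \<open>One \<open>d\<close> is lost to the size of the noise and one to the part the
    model absorbs.\<close>
  have low: "real n * (1 - 2 * d) \<le> w \<bullet> w - hat_quad n x r w" if "r \<in> \<M>" for r
    using G1[OF that] G2(1) C1 by (simp add: algebra_simps)
  have nd: "real n * (1 - 2 * d) > 0" using n d by simp
  have R0: "RSS n x ?y s0 = \<sigma>\<^sup>2 * (w \<bullet> w - hat_quad n x s0 w)" using RSS_super fin0 by blast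
  have R0pos: "RSS n x ?y s0 > 0" unfolding R0 using S low[OF s0M] nd by (intro mult_pos_pos) auto
  have R0le: "RSS n x ?y s0 \<le> 2 * \<sigma>\<^sup>2 * real n"
  proof -
    have "\<sigma>\<^sup>2 * (w \<bullet> w - hat_quad n x s0 w) \<le> \<sigma>\<^sup>2 * (2 * real n)"
      using q0[OF fin0] G2(2) by (intro mult_left_mono) auto
    then show ?thesis unfolding R0 by (simp add: ac_simps)
  qed
  show ?thesis
  proof (cases "s0 \<subseteq> s")
    case True
    then have "s0 \<subset> s" using s by auto
    define m where "m = card (s - s0)"
    have cs: "card s = p0 + m"
      using True fin fin0 card_Diff_subset[of s0 s] card_mono[of s s0] by (simp add: m_def p0_def)
    have m: "m \<ge> 1" using \<open>s0 \<subset> s\<close> fin by (simp add: m_def Suc_le_eq card_gt_0_iff)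
    have R: "RSS n x ?y s = \<sigma>\<^sup>2 * (w \<bullet> w - hat_quad n x s w)" using RSS_super True fin by blast
    have "RSS n x ?y s0 - RSS n x ?y s = \<sigma>\<^sup>2 * (hat_quad n x s w - hat_quad n x s0 w)"
      unfolding R R0 by (simp add: algebra_simps)
    also have "\<dots> \<le> \<sigma>\<^sup>2 * (t * real m)"
      using G4[OF s(1) \<open>s0 \<subset> s\<close>] by (intro mult_left_mono) (auto simp: m_def)
    finally have diff: "RSS n x ?y s0 - RSS n x ?y s \<le> \<sigma>\<^sup>2 * (t * real m)" .
    have "\<sigma>\<^sup>2 * (real n * (1 - 2 * d)) \<le> RSS n x ?y s"
      unfolding R using low[OF s(1)] by (intro mult_left_mono) auto
    from criterion_gt_if_larger_model[OF R0pos diff this S d(1) _ n(1) m p0 _ t0 t]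
    show ?thesis using d fin(3) unfolding mBIC2_def cs p0_def[symmetric] by simp
  next
    case False
    let ?\<Delta> = "model_gap n p x \<beta> s"
    \<comment> \<open>The cross term uses up half of the gap; the other half is covered by
      \<open>gap\<close>, whose factor 2 stems from here.\<close>
    have "- (2 * \<sigma> * (gap_vec n p x \<beta> s \<bullet> w)) \<le> 2 * \<sigma> * (?\<Delta> / (4 * \<sigma>) + 2 * \<sigma> * C3 * u)"
      using mult_left_mono[OF G3[OF s(1)], of "2 * \<sigma>"] \<sigma> by simp
    also have "\<dots> = ?\<Delta> / 2 + 4 * \<sigma>\<^sup>2 * C3 * u" using \<sigma> by (simp add: field_simps power2_eq_square)
    finally have 1: "- (2 * \<sigma> * (gap_vec n p x \<beta> s \<bullet> w)) \<le> ?\<Delta> / 2 + 4 * \<sigma>\<^sup>2 * C3 * u" .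
    have 2: "\<sigma>\<^sup>2 * hat_quad n x s w \<le> \<sigma>\<^sup>2 * (C1 * u)" "0 \<le> \<sigma>\<^sup>2 * hat_quad n x s0 w"
      using G1[OF s(1)] q0[OF fin0] by (auto intro: mult_left_mono)
    have "RSS n x ?y s0 + B * u \<le> RSS n x ?y s"
      using 1 2 gap[OF s(1) False] unfolding R0 RSS[of s] by (simp add: algebra_simps)
    from criterion_gt_if_RSS_larger[OF R0pos R0le this[unfolded u_def] S B(1) B(2)[unfolded u_def] _ fin(3) cp p0 n]
    show ?thesis using k unfolding mBIC2_def p0_def by simp
  qed
qed

section \<open>Consequences of the growth conditions\<close>

locale growth_conditions =
  fixes p p0 :: "nat \<Rightarrow> nat" and k \<alpha> :: real
  assumes p_ge: "\<And>n. n \<ge> 1 \<Longrightarrow> p n \<ge> n"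
    and p0_ge: "\<And>n. n \<ge> 1 \<Longrightarrow> p0 n \<ge> 1"
    and k: "k > 1"
    and alpha: "1/2 \<le> \<alpha>" "\<alpha> < 1"
    and p0_growth: "(\<lambda>n. real (p0 n) ^ 2 * ln (real (p n))) \<in> O(\<lambda>n. real n powr \<alpha>)"
    and p_growth: "(\<lambda>n. ln (real (p n))) \<in> o(\<lambda>n. real n powr (1 - \<alpha>) * ln (real n))"
begin

abbreviation L :: "nat \<Rightarrow> real" where "L n \<equiv> ln (real (p n))"

text \<open>The relative error \<open>d\<close> for residual noise. The factor 1/24 makes its cost
  in \<open>threshold_le\<close>, at most 6 \<open>slack n * L n\<close>, a quarter of (1 -
  \<alpha>) ln n.\<close>

definition slack :: "nat \<Rightarrow> real" where
  "slack n = (1 - \<alpha>) / 24 * ln (real n) / L n"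

definition threshold :: "nat \<Rightarrow> real" where
  "threshold n = 2 * L n + (1 - \<alpha>) / 2 * ln (real n) + ln (L n)"

definition rate :: "nat \<Rightarrow> real" where
  "rate n = 2 * exp (1/2) * real n powr (- ((1 - \<alpha>) / 4))"

lemma eventually_ln_ge: "eventually (\<lambda>n. c \<le> ln (real n)) sequentially"
  by (rule eventually_compose_filterlim[OF eventually_ge_at_top]) real_asymp

lemma eventually_L_ge: "eventually (\<lambda>n. 1 \<le> ln (real n) \<and> ln (real n) \<le> L n) sequentially"
  using eventually_ln_ge[of 1] eventually_ge_at_top[of 1]
proof eventually_elim
  case (elim n)
  then show ?case using p_ge[of n] by simp
qed

lemma L_le:
  assumes "e > 0"
  shows "eventually (\<lambda>n. L n \<le> e * (real n powr (1 - \<alpha>) * ln (real n))) sequentially"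
  using landau_o.smallD[OF p_growth assms] eventually_ge_at_top[of 1]
  by eventually_elim simp

lemma p0_sq_L_le: "\<exists>C>0. eventually (\<lambda>n. real (p0 n) ^ 2 * L n \<le> C * real n powr \<alpha>) sequentially"
proof -
  obtain C where C: "C > 0"
    "eventually (\<lambda>n. norm (real (p0 n) ^ 2 * L n) \<le> C * norm (real n powr \<alpha>)) sequentially"
    using landau_o.bigE[OF p0_growth] by blast
  from C(2) have "eventually (\<lambda>n. real (p0 n) ^ 2 * L n \<le> C * real n powr \<alpha>) sequentially"
    by eventually_elim auto
  then show ?thesis using C(1) by blast
qed

lemma p0_L_le: "\<exists>C>0. eventually (\<lambda>n. real (p0 n) * L n \<le> C * real n powr \<alpha>) sequentially"
proof -
  obtain C where C: "C > 0" "eventually (\<lambda>n. real (p0 n) ^ 2 * L n \<le> C * real n powr \<alpha>) sequentially"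
    using p0_sq_L_le by blast
  from C(2) eventually_L_ge eventually_ge_at_top[of 1]
  have "eventually (\<lambda>n. real (p0 n) * L n \<le> C * real n powr \<alpha>) sequentially"
  proof eventually_elim
    case (elim n)
    have "real (p0 n) \<le> real (p0 n) ^ 2"
      using p0_ge[of n] elim by (simp add: power2_eq_square)
    then have "real (p0 n) * L n \<le> real (p0 n) ^ 2 * L n" using elim by (intro mult_right_mono) auto
    then show ?case using elim(1) by linarith
  qed
  then show ?thesis using C(1) by blast
qed

lemma eventually_p0_L_le_n:
  assumes "S > 0"
  shows "eventually (\<lambda>n. B * (real (p0 n) * L n) \<le> S * real n) sequentially"
proof -
  obtain C where C: "C > 0" "eventually (\<lambda>n. real (p0 n) * L n \<le> C * real n powr \<alpha>) sequentially"
    using p0_L_le by blast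
  have "(\<lambda>n. real n powr (\<alpha> - 1)) \<longlonglongrightarrow> 0"
    using alpha tendsto_neg_powr[OF _ filterlim_real_sequentially, of "\<alpha> - 1"] by simp
  then have "eventually (\<lambda>n. real n powr (\<alpha> - 1) < S / ((\<bar>B\<bar> + 1) * C)) sequentially"
    using C(1) assms by (intro order_tendstoD) (auto intro!: divide_pos_pos mult_pos_pos)
  with C(2) eventually_ge_at_top[of 1] eventually_L_ge show ?thesis
  proof eventually_elim
    case (elim n)
    have "real n powr (\<alpha> - 1) * ((\<bar>B\<bar> + 1) * C) < S"
      using elim(4) C(1) by (subst (asm) pos_less_divide_eq) auto
    then have bd: "(\<bar>B\<bar> + 1) * C * real n powr (\<alpha> - 1) \<le> S" by (simp add: mult.commute)
    have "B * (real (p0 n) * L n) \<le> (\<bar>B\<bar> + 1) * (real (p0 n) * L n)"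
      by (rule mult_right_mono) (use elim in simp_all)
    also have "\<dots> \<le> (\<bar>B\<bar> + 1) * (C * real n powr \<alpha>)"
      by (rule mult_left_mono[OF elim(1)]) simp
    also have "real n powr \<alpha> = real n powr (\<alpha> - 1) * real n"
      using elim powr_add[of "real n" "\<alpha> - 1" 1] by simp
    also have "(\<bar>B\<bar> + 1) * (C * (real n powr (\<alpha> - 1) * real n)) = ((\<bar>B\<bar> + 1) * C * real n powr (\<alpha> - 1)) * real n"
      by simp
    also have "\<dots> \<le> S * real n"
      using bd by (rule mult_right_mono) simp
    finally show ?case .
  qed
qed

lemma slack_bounds: "eventually (\<lambda>n. 0 \<le> slack n \<and> slack n \<le> 1/24) sequentially"
  using eventually_L_ge
proof eventually_elim
  case (elim n)
  then have "ln (real n) / L n \<le> 1" "0 \<le> ln (real n) / L n" by auto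
  moreover from this have "(1 - \<alpha>) / 24 * (ln (real n) / L n) \<le> 1/24 * 1"
    using alpha by (intro mult_mono) auto
  moreover have "0 \<le> (1 - \<alpha>) / 24 * (ln (real n) / L n)"
    by (rule mult_nonneg_nonneg) (use alpha elim in simp_all)
  ultimately show ?case unfolding slack_def times_divide_eq_right by linarith
qed

text \<open>Both growth conditions combine: O(n^\<alpha>) times o(n^(1-\<alpha>) ln n) gives p0 (ln
  p)^2 = o(n ln n), and division by ln p produces the order of
  \<open>slack n * real n\<close>.\<close>

lemma eventually_p0_L_le_slack:
  "eventually (\<lambda>n. B * (real (p0 n) * L n) \<le> slack n * real n) sequentially"
proof -
  obtain C where C: "C > 0" "eventually (\<lambda>n. real (p0 n) * L n \<le> C * real n powr \<alpha>) sequentially"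
    using p0_L_le by blast
  define b where "b = \<bar>B\<bar> + 1"
  define h where "h = (1 - \<alpha>) / 24"
  have h: "h > 0" and b: "b > 0" using alpha by (auto simp: h_def b_def)
  \<comment> \<open>The small constant cancels \<open>b\<close> and \<open>C\<close> and leaves
    \<open>h\<close>, the constant in \<open>slack\<close>.\<close>
  have "h / (b * C) > 0" using h b C(1) by simp
  note L_le[OF this]
  with C(2) eventually_ge_at_top[of 1] eventually_L_ge show ?thesis
  proof eventually_elim
    case (elim n)
    have "B * (real (p0 n) * L n) \<le> b * (real (p0 n) * L n)"
      by (rule mult_right_mono) (use elim in \<open>simp_all add: b_def\<close>)
    also have "\<dots> \<le> b * (C * real n powr \<alpha>)"
      by (rule mult_left_mono[OF elim(1)]) (use b in simp)
    finally have st: "B * (real (p0 n) * L n) \<le> b * (C * real n powr \<alpha>)" .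
    have "B * (real (p0 n) * L n) * L n \<le> b * (C * real n powr \<alpha>) * (h / (b * C) * (real n powr (1 - \<alpha>) * ln (real n)))"
      by (rule mult_mono[OF st]) (use elim b C(1) in simp_all)
    also have "\<dots> = h * (real n powr \<alpha> * real n powr (1 - \<alpha>)) * ln (real n)"
      using b C(1) by (simp add: field_simps)
    also have "real n powr \<alpha> * real n powr (1 - \<alpha>) = real n"
      using elim by (simp flip: powr_add)
    finally have "B * (real (p0 n) * L n) * L n \<le> h * real n * ln (real n)" .
    then have "B * (real (p0 n) * L n) \<le> h * real n * ln (real n) / L n"
      using elim by (simp add: pos_le_divide_eq)
    then show ?case by (simp add: slack_def h_def ac_simps)
  qed
qed

text \<open>Here \<alpha> \<ge> 1/2 enters: n^(1-\<alpha>) is at most the square root of n, so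
  \<open>slack n\<close> dominates n^(-1/2) and the squared noise norm can be controlled to that
  precision.\<close>

lemma slack_sq_at_top: "filterlim (\<lambda>n. real n * (slack n)\<^sup>2) at_top sequentially"
  unfolding filterlim_at_top
proof
  fix T :: real
  define h where "h = (1 - \<alpha>) / 24"
  have h: "h > 0" using alpha by (auto simp: h_def)
  define e where "e = h / sqrt (\<bar>T\<bar> + 1)"
  have e: "e > 0" using h by (auto simp: e_def intro!: divide_pos_pos)
  show "eventually (\<lambda>n. T \<le> real n * (slack n)\<^sup>2) sequentially"
    using L_le[OF e] eventually_ge_at_top[of 1] eventually_L_ge
  proof eventually_elim
    case (elim n)
    have "real n powr (1 - \<alpha>) \<le> real n powr (1/2)"
      using elim alpha by (intro powr_mono) auto
    then have "real n powr (1 - \<alpha>) \<le> sqrt (real n)" using elim by (simp add: powr_half_sqrt)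
    then have "e * (real n powr (1 - \<alpha>) * ln (real n)) \<le> e * (sqrt (real n) * ln (real n))"
      using e elim by (intro mult_left_mono mult_right_mono) auto
    then have "L n \<le> e * (sqrt (real n) * ln (real n))" using elim by simp
    then have "(L n)\<^sup>2 \<le> (e * (sqrt (real n) * ln (real n)))\<^sup>2"
      using elim by (intro power_mono) auto
    also have "\<dots> = h\<^sup>2 / (\<bar>T\<bar> + 1) * (real n * (ln (real n))\<^sup>2)"
      by (simp add: e_def power_mult_distrib power_divide)
    finally have "(L n)\<^sup>2 * (\<bar>T\<bar> + 1) \<le> real n * (h * ln (real n))\<^sup>2"
      by (simp add: field_simps power_mult_distrib)
    then have "\<bar>T\<bar> + 1 \<le> real n * (h * ln (real n))\<^sup>2 / (L n)\<^sup>2"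
      using elim by (simp add: pos_le_divide_eq mult.commute)
    also have "\<dots> = real n * (slack n)\<^sup>2"
      by (simp add: slack_def h_def power_divide power_mult_distrib)
    finally show ?case by simp
  qed
qed

lemma threshold_gt_1:
  "eventually (\<lambda>n. 1 < threshold n) sequentially"
  using eventually_L_ge
proof eventually_elim
  case (elim n)
  have "0 \<le> (1 - \<alpha>) / 2 * ln (real n)" using alpha elim by (intro mult_nonneg_nonneg) auto
  moreover have "0 \<le> ln (L n)" using elim by simp
  ultimately show ?case using elim unfolding threshold_def by linarith
qed

text \<open>The bound on p0^2 ln p limits 2 ln p0 + ln ln p by \<alpha> ln n plus a constant, so the
  bracket exceeds 2 ln p + ln ln p by (1 - \<alpha>) ln n up to \<open>C'\<close>. Of this surplus,
  two quarters go to \<open>threshold\<close>, one to \<open>slack\<close>, and one absorbs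
  \<open>C' + 1\<close>.\<close>

lemma threshold_le:
  "eventually (\<lambda>n. threshold n \<le> (1 - 2 * slack n) *
     (ln (real n) + 2 * L n - 2 * ln (k * real (p0 n))) - 1) sequentially"
proof -
  obtain C where C: "C > 0" "eventually (\<lambda>n. real (p0 n) ^ 2 * L n \<le> C * real n powr \<alpha>) sequentially"
    using p0_sq_L_le by blast
  define C' where "C' = 2 * ln k + ln C"
  from C(2) eventually_L_ge eventually_ge_at_top[of 1] slack_bounds
    eventually_ln_ge[of "(C' + 1) / ((1 - \<alpha>) / 4)"]
  show ?thesis
  proof eventually_elim
    case (elim n)
    have p0: "p0 n \<ge> 1" using p0_ge elim by simp
    have n: "n \<ge> 1" and L1: "L n \<ge> 1" and lnL: "ln (real n) \<le> L n" "1 \<le> ln (real n)" using elim by auto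
    let ?\<Lambda> = "ln (real n) + 2 * L n - 2 * ln (k * real (p0 n))"
    have "ln (real (p0 n) ^ 2 * L n) \<le> ln (C * real n powr \<alpha>)"
      using elim p0 L1 by (intro ln_mono) auto
    then have "2 * ln (real (p0 n)) + ln (L n) \<le> ln C + \<alpha> * ln (real n)"
      using p0 L1 C(1) n by (simp add: ln_mult ln_realpow ln_powr)
    moreover have "ln (k * real (p0 n)) = ln k + ln (real (p0 n))"
      using k p0 by (simp add: ln_mult)
    ultimately have low: "?\<Lambda> \<ge> (1 - \<alpha>) * ln (real n) + 2 * L n + ln (L n) - C'"
      by (simp add: C'_def algebra_simps)
    have "1 * 1 \<le> k * real (p0 n)" using k p0 by (intro mult_mono) auto
    then have "ln (k * real (p0 n)) \<ge> 0" by simp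
    then have up: "?\<Lambda> \<le> 3 * L n" using lnL by simp
    have "2 * slack n * ?\<Lambda> \<le> 2 * slack n * (3 * L n)"
      using up elim by (intro mult_left_mono) auto
    also have "\<dots> = (1 - \<alpha>) / 4 * ln (real n)" using L1 by (simp add: slack_def)
    finally have "2 * slack n * ?\<Lambda> \<le> (1 - \<alpha>) / 4 * ln (real n)" .
    moreover have "C' + 1 \<le> (1 - \<alpha>) / 4 * ln (real n)"
      using elim alpha by (simp add: field_simps)
    moreover define X where "X = ?\<Lambda>"
    moreover have "(1 - \<alpha>) * ln (real n) = 4 * ((1 - \<alpha>) / 4 * ln (real n))"
      "(1 - \<alpha>) / 2 * ln (real n) = 2 * ((1 - \<alpha>) / 4 * ln (real n))" by simp_all
    ultimately have "threshold n \<le> X - 2 * slack n * X - 1"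
      using low unfolding threshold_def X_def[symmetric] by linarith
    then show ?case by (simp add: X_def algebra_simps)
  qed
qed

lemma rate_tendsto: "rate \<longlonglongrightarrow> 0"
proof -
  have "(\<lambda>n. real n powr (- ((1 - \<alpha>) / 4))) \<longlonglongrightarrow> 0"
    using alpha tendsto_neg_powr[OF _ filterlim_real_sequentially, of "- ((1 - \<alpha>) / 4)"] by simp
  from tendsto_mult_left[OF this, of "2 * exp (1/2)"] show ?thesis
    unfolding rate_def by simp
qed

lemma rate_nonneg: "rate n \<ge> 0"
  by (simp add: rate_def)

text \<open>The root of \<open>threshold n\<close> is at most twice that of ln p, and the
  exponential carries exactly the inverse root of ln p from the ln ln p term.\<close>

lemma threshold_rate:
  "eventually (\<lambda>n. sqrt (threshold n) * exp ((1 - threshold n) / 2) \<le> rate n / real (p n)) sequentially"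
  using eventually_L_ge eventually_ge_at_top[of 1]
proof eventually_elim
  case (elim n)
  have L1: "L n \<ge> 1" and n: "n \<ge> 1" using elim by auto
  have p: "p n \<ge> 1" using p_ge[of n] n by simp
  have "(1 - \<alpha>) / 2 * ln (real n) \<le> 1 * L n" using alpha elim by (intro mult_mono) auto
  moreover have "ln (L n) \<le> L n" using ln_le_minus_one[of "L n"] L1 by simp
  ultimately have "threshold n \<le> 4 * L n" by (simp add: threshold_def)
  then have "sqrt (threshold n) \<le> sqrt (4 * L n)" by simp
  also have "\<dots> = 2 * sqrt (L n)" by (simp add: real_sqrt_mult)
  finally have 1: "sqrt (threshold n) \<le> 2 * sqrt (L n)" .
  have "(1 - threshold n) / 2 = 1/2 + - L n + - ((1 - \<alpha>) / 4) * ln (real n) + - (ln (L n) / 2)"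
    by (simp add: threshold_def field_simps)
  moreover have "exp (ln (L n) / 2) = sqrt (L n)"
    using L1 powr_half_sqrt[of "L n"] by (simp add: powr_def)
  ultimately have 2: "exp ((1 - threshold n) / 2)
      = exp (1/2) * (1 / real (p n)) * real n powr (- ((1 - \<alpha>) / 4)) * (1 / sqrt (L n))"
    using p n by (simp only: exp_add) (simp add: powr_def exp_minus inverse_eq_divide)
  have "sqrt (threshold n) * exp ((1 - threshold n) / 2) \<le> 2 * sqrt (L n) * exp ((1 - threshold n) / 2)"
    using 1 by (intro mult_right_mono) auto
  also have "\<dots> = rate n / real (p n)" unfolding 2 rate_def using L1 by simp
  finally show ?case .
qed

end

section \<open>Consistency\<close>

context std_gaussian
begin

text \<open>Chernoff with parameter d/4, then ln(1 + y) \<ge> y - y^2 at y = d/2. The dependence on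
  \<open>d\<close> is kept explicit because \<open>slack n\<close>, which may tend to zero, is
  inserted later.\<close>

lemma prob_W_W_small:
  assumes d: "0 < d" "d \<le> 1"
  shows "prob {\<omega> \<in> space M. W \<omega> \<bullet> W \<omega> \<le> real n * (1 - d)} \<le> exp (- (real n * d\<^sup>2 / 8))"
proof -
  have "prob {\<omega> \<in> space M. W \<omega> \<bullet> W \<omega> \<le> real n * (1 - d)}
      \<le> exp (d / 4 * (real n * (1 - d))) * (1 / sqrt (1 + 2 * (d / 4))) ^ n"
    using d by (intro prob_W_W_le) auto
  also have "(1 / sqrt (1 + 2 * (d / 4))) ^ n = exp (- (real n / 2 * ln (1 + d / 2)))"
  proof -
    have "1 / sqrt (1 + d / 2) = exp (- (ln (1 + d / 2) / 2))"
      using d powr_half_sqrt[of "1 + d / 2"] by (simp add: powr_def exp_minus inverse_eq_divide)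
    then show ?thesis by (simp flip: exp_of_nat_mult)
  qed
  also have "exp (d / 4 * (real n * (1 - d))) * \<dots> = exp (real n / 2 * (d / 2 * (1 - d) - ln (1 + d / 2)))"
    by (simp add: algebra_simps flip: exp_add)
  also have "\<dots> \<le> exp (- (real n * d\<^sup>2 / 8))"
  proof -
    have "d / 2 - (d / 2)\<^sup>2 \<le> ln (1 + d / 2)"
      using d by (intro ln_one_plus_pos_lower_bound) auto
    then have "d / 2 * (1 - d) - ln (1 + d / 2) \<le> - (d\<^sup>2 / 4)"
      by (simp add: power2_eq_square field_simps)
    from mult_left_mono[OF this, of "real n / 2"] show ?thesis by simp
  qed
  finally show ?thesis .
qed

lemma prob_W_W_large:
  "prob {\<omega> \<in> space M. W \<omega> \<bullet> W \<omega> \<ge> 2 * real n} \<le> (sqrt 2 * exp (- 1 / 2)) ^ n"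
proof -
  have "prob {\<omega> \<in> space M. W \<omega> \<bullet> W \<omega> \<ge> 2 * real n}
      \<le> exp (- (1 / 4 * (2 * real n))) * (1 / sqrt (1 - 2 * (1 / 4))) ^ n"
    by (intro prob_W_W_ge) auto
  also have "exp (- (1 / 4 * (2 * real n))) = exp (- 1 / 2) ^ n"
    by (simp flip: exp_of_nat_mult)
  also have "1 / sqrt (1 - 2 * (1 / 4)) = sqrt 2" by (simp add: real_sqrt_divide)
  finally show ?thesis by (simp add: power_mult_distrib mult.commute)
qed

lemma mBIC2_measurable:
  assumes "finite s"
  shows "(\<lambda>\<omega>. mBIC2 n p x (mean_vec n p x \<beta> + \<sigma> \<cdot>\<^sub>v W \<omega>) s) \<in> borel_measurable M"
proof -
  note [measurable] = hat_quad_W_measurable[OF assms]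
  have "RSS n x (mean_vec n p x \<beta> + \<sigma> \<cdot>\<^sub>v W \<omega>) s = model_gap n p x \<beta> s
      + 2 * \<sigma> * (gap_vec n p x \<beta> s \<bullet> W \<omega>) + \<sigma>\<^sup>2 * (W \<omega> \<bullet> W \<omega> - hat_quad n x s (W \<omega>))" for \<omega>
    by (rule RSS_mean_plus_smult) simp
  then show ?thesis unfolding mBIC2_def by simp
qed

lemma prob_mBIC2_minimal_ge:
  fixes x :: "nat \<Rightarrow> nat \<Rightarrow> real" and \<beta> :: "nat \<Rightarrow> real" and p :: nat and \<sigma> k d t B b :: real
  defines "s0 \<equiv> true_model p \<beta>"
  defines "p0 \<equiv> card s0"
  defines "u \<equiv> real p0 * ln (real p)"
  defines "\<M> \<equiv> models_upto p (k * real p0)"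
  defines "y \<equiv> \<lambda>\<omega>. mean_vec n p x \<beta> + \<sigma> \<cdot>\<^sub>v W \<omega>"
  assumes \<sigma>: "\<sigma> > 0" and k: "k > 1"
    and n: "n \<ge> 1" "n \<le> p" "p \<ge> 2" and p0: "p0 \<ge> 1" and L: "ln (real p) \<ge> 1"
    and d: "0 < d" "d \<le> 1/4" and C1: "4 * (2 * k + 1) * u \<le> d * real n"
    and B: "B > 4 * \<sigma>\<^sup>2 * (3 + 2 * k)" "B * u \<le> \<sigma>\<^sup>2 * real n"
    and gap: "\<And>s. s \<in> \<M> \<Longrightarrow> \<not> s0 \<subseteq> s \<Longrightarrow>
      2 * (B + 4 * \<sigma>\<^sup>2 * (k + 1) + \<sigma>\<^sup>2 * (4 * (2 * k + 1))) * u \<le> model_gap n p x \<beta> s"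
    and t1: "1 < t"
    and t: "t \<le> (1 - 2 * d) * (ln (real n) + 2 * ln (real p) - 2 * ln (k * real p0)) - 1"
    and b: "0 \<le> b" "b \<le> 1" and tb: "sqrt t * exp ((1 - t) / 2) \<le> b / real p"
  shows "1 - (2 * exp 1 * exp (- u) + exp (- (real n * d\<^sup>2 / 8)) + (sqrt 2 * exp (- 1 / 2)) ^ n + b * exp 1)
    \<le> prob {\<omega> \<in> space M. \<forall>s\<in>\<M>. s \<noteq> s0 \<longrightarrow> mBIC2 n p x (y \<omega>) s > mBIC2 n p x (y \<omega>) s0}"
proof -
  define K where "K = k * real p0"
  have p1: "p \<ge> 1" using n by simp
  have d0: "0 \<le> d" and t0: "0 \<le> t" using d t1 by simp_all
  have K1: "K \<ge> 1" using k p0 mult_mono[of 1 k 1 "real p0"] by (simp add: K_def)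
  have \<M>: "\<M> = models_upto p K" by (simp add: \<M>_def K_def)
  have finM: "finite \<M>" unfolding \<M> by (rule finite_models_upto)
  have fin: "finite s" if "s \<in> \<M>" for s using that finite_subset by (auto simp: \<M>_def models_upto_def)
  have fin0: "finite s0" by (simp add: s0_def true_model_def)
  let ?r = "gap_vec n p x \<beta>"
  \<comment> \<open>This value turns the bias term of \<open>prob_gap_uniform\<close> into the gap
    divided by 4\<sigma>, as \<open>G3\<close> of the comparison requires.\<close>
  let ?l = "1 / (2 * \<sigma>)"
  let ?P1 = "\<lambda>s \<omega>. hat_quad n x s (W \<omega>) \<ge> 4 * (2 * K + real p0) * ln (real p)"
  let ?P2 = "\<lambda>s \<omega>. - (?r s \<bullet> W \<omega>) \<ge> ?l * (?r s \<bullet> ?r s) / 2 + (K + real p0) * ln (real p) / ?l"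
  let ?P3 = "\<lambda>s \<omega>. hat_quad n x s (W \<omega>) - hat_quad n x s0 (W \<omega>) \<ge> t * real (card (s - s0))"
  let ?G = "{\<omega> \<in> space M. \<forall>s\<in>\<M>. s \<noteq> s0 \<longrightarrow> mBIC2 n p x (y \<omega>) s > mBIC2 n p x (y \<omega>) s0}"
  define A1 where "A1 = {\<omega> \<in> space M. \<exists>s\<in>\<M>. ?P1 s \<omega>}"
  define A2 where "A2 = {\<omega> \<in> space M. \<exists>s\<in>\<M>. ?P2 s \<omega>}"
  define A3 where "A3 = {\<omega> \<in> space M. \<exists>s\<in>{s \<in> \<M>. s0 \<subset> s}. ?P3 s \<omega>}"
  define A4 where "A4 = {\<omega> \<in> space M. W \<omega> \<bullet> W \<omega> \<le> real n * (1 - d)}"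
  define A5 where "A5 = {\<omega> \<in> space M. W \<omega> \<bullet> W \<omega> \<ge> 2 * real n}"
  have q: "(\<lambda>\<omega>. hat_quad n x s (W \<omega>)) \<in> borel_measurable M" if "s \<in> \<M>" for s
    using hat_quad_W_measurable[OF fin[OF that]] .
  note [measurable] = hat_quad_W_measurable[OF fin0]
  have "A1 \<in> sets M" "A2 \<in> sets M" "A4 \<in> sets M" "A5 \<in> sets M"
    unfolding A1_def A2_def A4_def A5_def using finM q
    by (auto intro!: sets.sets_Collect_finite_Ex)
  moreover have "A3 \<in> sets M"
    unfolding A3_def using finM q by (intro sets.sets_Collect_finite_Ex) auto
  ultimately have sets: "A1 \<in> sets M" "A2 \<in> sets M" "A3 \<in> sets M" "A4 \<in> sets M" "A5 \<in> sets M"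
    by simp_all
  have Gs: "?G \<in> sets M"
  proof -
    have "?G = {\<omega> \<in> space M. \<forall>s\<in>\<M> - {s0}. mBIC2 n p x (y \<omega>) s > mBIC2 n p x (y \<omega>) s0}" by auto
    also have "\<dots> \<in> sets M"
    proof (rule sets.sets_Collect_finite_All)
      fix s assume "s \<in> \<M> - {s0}"
      then have "finite s" using fin by blast
      note [measurable] = mBIC2_measurable[OF this] mBIC2_measurable[OF fin0]
      show "{\<omega> \<in> space M. mBIC2 n p x (y \<omega>) s > mBIC2 n p x (y \<omega>) s0} \<in> sets M"
        unfolding y_def by measurable
    qed (use finM in simp)
    finally show ?thesis .
  qed
  have "space M \<subseteq> ?G \<union> (A1 \<union> (A2 \<union> (A3 \<union> (A4 \<union> A5))))"
  proof
    fix \<omega> assume \<omega>: "\<omega> \<in> space M"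
    show "\<omega> \<in> ?G \<union> (A1 \<union> (A2 \<union> (A3 \<union> (A4 \<union> A5))))"
    proof (rule ccontr)
      assume neg: "\<omega> \<notin> ?G \<union> (A1 \<union> (A2 \<union> (A3 \<union> (A4 \<union> A5))))"
      have 1: "hat_quad n x s (W \<omega>) \<le> 4 * (2 * k + 1) * u" if "s \<in> \<M>" for s
      proof -
        have "\<not> ?P1 s \<omega>" using neg \<omega> that by (auto simp: A1_def)
        then show ?thesis by (simp add: K_def u_def algebra_simps)
      qed
      have 2: "- (?r s \<bullet> W \<omega>) \<le> model_gap n p x \<beta> s / (4 * \<sigma>) + 2 * \<sigma> * (k + 1) * u" if "s \<in> \<M>" for s
      proof -
        have "\<not> ?P2 s \<omega>" using neg \<omega> that by (auto simp: A2_def)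
        then show ?thesis using \<sigma> by (simp add: K_def u_def model_gap_eq algebra_simps)
      qed
      have 3: "hat_quad n x s (W \<omega>) - hat_quad n x s0 (W \<omega>) \<le> t * real (card (s - s0))"
        if "s \<in> \<M>" "s0 \<subset> s" for s
      proof -
        have "\<not> ?P3 s \<omega>" using neg \<omega> that by (auto simp: A3_def)
        then show ?thesis by simp
      qed
      have 4: "real n * (1 - d) \<le> W \<omega> \<bullet> W \<omega>" "W \<omega> \<bullet> W \<omega> \<le> 2 * real n"
        using neg \<omega> by (auto simp: A4_def A5_def)
      have "mBIC2 n p x (y \<omega>) s0 < mBIC2 n p x (y \<omega>) s" if "s \<in> \<M>" "s \<noteq> s0" for s
        unfolding y_def
        by (rule mBIC2_minimal_at_true_model[where p = p and \<beta> = \<beta> and k = k, folded s0_def,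
              folded p0_def, folded u_def \<M>_def, OF W_carrier \<sigma> k n p0 d0 d(2) C1 B gap t0 t 1 4 2 3 that])
      then show False using neg \<omega> by auto
    qed
  qed
  then have "prob (space M) \<le> prob (?G \<union> (A1 \<union> (A2 \<union> (A3 \<union> (A4 \<union> A5)))))"
    using sets Gs by (intro finite_measure_mono) auto
  also have "\<dots> \<le> prob ?G + (prob A1 + (prob A2 + (prob A3 + (prob A4 + prob A5))))"
    using sets Gs by (intro order.trans[OF measure_Un_le] add_left_mono) auto
  finally have "1 \<le> prob ?G + (prob A1 + (prob A2 + (prob A3 + (prob A4 + prob A5))))"
    by (simp add: prob_space)
  moreover have "prob A1 \<le> exp (- u) * exp 1"
    unfolding A1_def \<M> u_def by (rule prob_hat_quad_uniform[OF p1 L K1])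
  moreover have "prob A2 \<le> exp (- u) * exp 1"
    unfolding A2_def \<M> u_def using \<sigma> by (intro prob_gap_uniform[OF p1]) (auto simp: gap_vec_carrier)
  moreover have "prob A3 \<le> b * exp 1"
    unfolding A3_def \<M> by (rule prob_hat_quad_increment_uniform[OF p1 t1 b tb])
  moreover have "prob A4 \<le> exp (- (real n * d\<^sup>2 / 8))"
    unfolding A4_def using d by (intro prob_W_W_small) auto
  moreover have "prob A5 \<le> (sqrt 2 * exp (- 1 / 2)) ^ n"
    unfolding A5_def by (rule prob_W_W_large)
  ultimately show ?thesis by (simp add: ac_simps)
qed

end

section \<open>Passage to the limit\<close>

theorem theorem2:
  fixes M :: "nat \<Rightarrow> 'a measure"
    and \<epsilon> :: "nat \<Rightarrow> nat \<Rightarrow> 'a \<Rightarrow> real"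
    and p :: "nat \<Rightarrow> nat"
    and x :: "nat \<Rightarrow> nat \<Rightarrow> nat \<Rightarrow> real"
    and \<beta> :: "nat \<Rightarrow> nat \<Rightarrow> real"
    and s\<^sub>0 :: "nat \<Rightarrow> nat set"
    and p\<^sub>0 :: "nat \<Rightarrow> nat"
    and K :: "nat \<Rightarrow> real"
    and \<sigma> k \<alpha> :: real
  assumes prob: "\<And>n. n \<ge> 1 \<Longrightarrow> prob_space (M n)"
    and indep: "\<And>n. n \<ge> 1 \<Longrightarrow> prob_space.indep_vars (M n) (\<lambda>_. borel) (\<epsilon> n) {1..n}"
    and gauss: "\<And>n i. i \<in> {1..n} \<Longrightarrow> distributed (M n) lborel (\<epsilon> n i) (normal_density 0 \<sigma>)"
    and sigma: "\<sigma> > 0"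
    and p_ge: "\<And>n. n \<ge> 1 \<Longrightarrow> p n \<ge> n"
    and s0: "\<And>n. s\<^sub>0 n = true_model (p n) (\<beta> n)"
    and p0: "\<And>n. p\<^sub>0 n = card (s\<^sub>0 n)"
    and p0_ge: "\<And>n. n \<ge> 1 \<Longrightarrow> p\<^sub>0 n \<ge> 1"
    and k: "k > 1"
    and K: "\<And>n. K n = k * real (p\<^sub>0 n)"
    and consistency_condition:
      "filterlim
         (\<lambda>n. MIN s \<in> {s \<in> models_upto (p n) (K n). \<not> s\<^sub>0 n \<subseteq> s}.
                model_gap n (p n) (x n) (\<beta> n) s / (real (p\<^sub>0 n) * ln (real (p n))))
         at_top sequentially"
    and alpha: "1/2 \<le> \<alpha>" "\<alpha> < 1"
    and p0_growth: "(\<lambda>n. real (p\<^sub>0 n) ^ 2 * ln (real (p n))) \<in> O(\<lambda>n. real n powr \<alpha>)"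
    and p_growth: "(\<lambda>n. ln (real (p n))) \<in> o(\<lambda>n. real n powr (1 - \<alpha>) * ln (real n))"
  shows "(\<lambda>n. measure (M n)
            {\<omega> \<in> space (M n).
               let y = response n (p n) (x n) (\<beta> n) (\<lambda>i. \<epsilon> n i \<omega>) in
               \<forall>s \<in> models_upto (p n) (K n). s \<noteq> s\<^sub>0 n \<longrightarrow>
                 mBIC2 n (p n) (x n) y s > mBIC2 n (p n) (x n) y (s\<^sub>0 n)})
         \<longlonglongrightarrow> 1"
proof -
  interpret G: growth_conditions p p\<^sub>0 k \<alpha>
    by unfold_locales (use p_ge p0_ge k alpha p0_growth p_growth in auto)
  define B where "B = 4 * \<sigma>\<^sup>2 * (3 + 2 * k) + 1"
  \<comment> \<open>The gap required per unit of p0 ln p, with \<open>C3 = k + 1\<close> and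
    \<open>C1 = 4 * (2 * k + 1)\<close> from the uniform bounds at q = p0.\<close>
  define B2 where "B2 = 2 * (B + 4 * \<sigma>\<^sup>2 * (k + 1) + \<sigma>\<^sup>2 * (4 * (2 * k + 1)))"
  define Z where "Z n i \<omega> = \<epsilon> n i \<omega> / \<sigma>" for n i \<omega>
  define bound where "bound n = 2 * exp 1 * exp (- (real (p\<^sub>0 n) * ln (real (p n))))
    + exp (- (real n * (G.slack n)\<^sup>2 / 8)) + (sqrt 2 * exp (- 1 / 2)) ^ n + G.rate n * exp 1" for n
  let ?prob = "\<lambda>n. measure (M n)
            {\<omega> \<in> space (M n).
               let y = response n (p n) (x n) (\<beta> n) (\<lambda>i. \<epsilon> n i \<omega>) in
               \<forall>s \<in> models_upto (p n) (K n). s \<noteq> s\<^sub>0 n \<longrightarrow>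
                 mBIC2 n (p n) (x n) y s > mBIC2 n (p n) (x n) y (s\<^sub>0 n)}"
  have S: "\<sigma>\<^sup>2 > 0" using sigma by simp
  have gap: "eventually (\<lambda>n. B2 \<le> (MIN s \<in> {s \<in> models_upto (p n) (K n). \<not> s\<^sub>0 n \<subseteq> s}.
      model_gap n (p n) (x n) (\<beta> n) s / (real (p\<^sub>0 n) * ln (real (p n))))) sequentially"
    using consistency_condition unfolding filterlim_at_top by blast
  \<comment> \<open>The increment bound needs \<open>b\<close> at most 1, and \<open>b\<close> will
    be \<open>G.rate n\<close>.\<close>
  have "eventually (\<lambda>n. G.rate n < 1) sequentially"
    using G.rate_tendsto by (rule order_tendstoD) simp
  with gap G.eventually_L_ge G.slack_bounds G.threshold_gt_1 G.threshold_le G.threshold_rate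
    G.eventually_p0_L_le_slack[of "4 * (2 * k + 1)"] G.eventually_p0_L_le_n[OF S, of B]
    eventually_ge_at_top[of 2]
  have lower: "eventually (\<lambda>n. 1 - bound n \<le> ?prob n) sequentially"
  proof eventually_elim
    case (elim n)
    have n: "n \<ge> 1" using elim by simp
    interpret prob_space "M n" by (rule prob[OF n])
    interpret std_gaussian "M n" n "Z n"
    proof
      show "indep_vars (\<lambda>_. borel) (Z n) {1..n}"
        unfolding Z_def by (rule indep_vars_compose2[OF indep[OF n]]) auto
      show "distributed (M n) lborel (Z n i) std_normal_density" if "i \<in> {1..n}" for i
        using gauss[OF that] normal_standard_normal_convert[OF sigma, of "\<epsilon> n i" 0]
        by (simp add: Z_def[abs_def])
    qed
    have resp: "response n (p n) (x n) (\<beta> n) (\<lambda>i. \<epsilon> n i \<omega>) = mean_vec n (p n) (x n) (\<beta> n) + \<sigma> \<cdot>\<^sub>v W \<omega>" for \<omega>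
    proof -
      have "vec n (\<lambda>i. \<epsilon> n (Suc i) \<omega>) = \<sigma> \<cdot>\<^sub>v W \<omega>"
        using sigma by (intro eq_vecI) (auto simp: W_def Z_def)
      then show ?thesis by (simp add: response_eq_mean_vec_plus)
    qed
    have slack: "0 < G.slack n"
      using elim alpha by (auto simp: G.slack_def intro!: divide_pos_pos mult_pos_pos)
    have L1: "1 \<le> ln (real (p n))" using elim by linarith
    have u: "real (p\<^sub>0 n) * ln (real (p n)) > 0" using p0_ge[OF n] elim by simp
    have "B2 * (real (p\<^sub>0 n) * ln (real (p n))) \<le> model_gap n (p n) (x n) (\<beta> n) s"
      if s: "s \<in> models_upto (p n) (K n)" "\<not> s\<^sub>0 n \<subseteq> s" for s
    proof -
      \<comment> \<open>The empty model belongs to this set, since \<open>s\<^sub>0 n\<close> is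
        nonempty, so the minimum is never over an empty set.\<close>
      have "(MIN s \<in> {s \<in> models_upto (p n) (K n). \<not> s\<^sub>0 n \<subseteq> s}.
          model_gap n (p n) (x n) (\<beta> n) s / (real (p\<^sub>0 n) * ln (real (p n))))
        \<le> model_gap n (p n) (x n) (\<beta> n) s / (real (p\<^sub>0 n) * ln (real (p n)))"
        using finite_models_upto s by (intro Min_le) auto
      then have "B2 \<le> model_gap n (p n) (x n) (\<beta> n) s / (real (p\<^sub>0 n) * ln (real (p n)))"
        using elim by linarith
      then show ?thesis using u by (simp only: pos_le_divide_eq)
    qed
    then have "1 - bound n \<le> prob {\<omega> \<in> space (M n).
        \<forall>s\<in>models_upto (p n) (k * real (card (true_model (p n) (\<beta> n)))). s \<noteq> true_model (p n) (\<beta> n) \<longrightarrow>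
          mBIC2 n (p n) (x n) (mean_vec n (p n) (x n) (\<beta> n) + \<sigma> \<cdot>\<^sub>v W \<omega>) s
          > mBIC2 n (p n) (x n) (mean_vec n (p n) (x n) (\<beta> n) + \<sigma> \<cdot>\<^sub>v W \<omega>) (true_model (p n) (\<beta> n))}"
      unfolding bound_def p0 s0
      using elim n sigma k p_ge[OF n] p0_ge[OF n] slack L1
      by (intro prob_mBIC2_minimal_ge[where t = "G.threshold n" and B = B])
        (auto simp: B_def B2_def K p0 s0 G.rate_nonneg)
    then show ?case by (simp add: resp K p0 s0 Let_def)
  qed
  have "bound \<longlonglongrightarrow> 2 * exp 1 * 0 + 0 + 0 + 0 * exp 1"
    unfolding bound_def
  proof (intro tendsto_add tendsto_mult tendsto_const)
    have "filterlim (\<lambda>n. real (p\<^sub>0 n) * ln (real (p n))) at_top sequentially"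
    proof (rule filterlim_at_top_mono)
      show "filterlim (\<lambda>n. ln (real n)) at_top sequentially" by real_asymp
      show "eventually (\<lambda>n. ln (real n) \<le> real (p\<^sub>0 n) * ln (real (p n))) sequentially"
        using G.eventually_L_ge eventually_ge_at_top[of 1]
      proof eventually_elim
        case (elim n)
        have "1 * ln (real (p n)) \<le> real (p\<^sub>0 n) * ln (real (p n))"
          using p0_ge[of n] elim by (intro mult_right_mono) auto
        then show ?case using elim by linarith
      qed
    qed
    then show "(\<lambda>n. exp (- (real (p\<^sub>0 n) * ln (real (p n))))) \<longlonglongrightarrow> 0"
      by (intro filterlim_compose[OF exp_at_bot] filterlim_uminus_at_bot_at_top[THEN filterlim_compose])
    have "filterlim (\<lambda>n. real n * (G.slack n)\<^sup>2 / 8) at_top sequentially"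
      using filterlim_tendsto_pos_mult_at_top[OF tendsto_const _ G.slack_sq_at_top, of "1/8"] by simp
    then show "(\<lambda>n. exp (- (real n * (G.slack n)\<^sup>2 / 8))) \<longlonglongrightarrow> 0"
      by (intro filterlim_compose[OF exp_at_bot] filterlim_uminus_at_bot_at_top[THEN filterlim_compose])
    \<comment> \<open>Amounts to 2 < e.\<close>
    have "sqrt 2 * exp (- 1 / 2) < (1::real)"
    proof -
      have "(2::real) < exp 1" using exp_lower_Taylor_quadratic[of 1] by simp
      then have "sqrt 2 < sqrt (exp 1)" by simp
      also have "sqrt (exp 1) = exp (1/2)"
        by (rule real_sqrt_unique) (simp_all add: power2_eq_square flip: exp_add)
      finally show ?thesis by (simp add: exp_minus field_simps)
    qed
    then show "(\<lambda>n. (sqrt 2 * exp (- 1 / 2)) ^ n) \<longlonglongrightarrow> (0::real)"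
      by (intro LIMSEQ_realpow_zero) auto
    show "G.rate \<longlonglongrightarrow> 0" by (rule G.rate_tendsto)
  qed
  then have lim: "(\<lambda>n. 1 - bound n) \<longlonglongrightarrow> 1"
    using tendsto_diff[OF tendsto_const, of bound 0 sequentially 1] by simp
  have upper: "eventually (\<lambda>n. ?prob n \<le> 1) sequentially"
    using eventually_ge_at_top[of 1] by eventually_elim (rule prob_space.prob_le_1[OF prob])
  show ?thesis by (rule tendsto_sandwich[OF lower upper lim tendsto_const])
qed

end
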